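(* Let $\Delta t>0$, $D>0$. Let $(n^m,p^m)_{m\ge0}$ be the numerical solution, with $n^m,p^m\in\mathcal{C}_{\rm per}$ pointwise positive and $n^m-p^m\in\mathring{\mathcal{C}}_{\rm per}$ for all $m\ge 0$, of the scheme $$\frac{n^{m+1}-n^m}{\Delta t}=\nabla_h\cdot\left(\breve{\mathcal M}_n^m\nabla_h\mu_n^{m+1}\right),\qquad \frac{p^{m+1}-p^m}{\Delta t}=\nabla_h\cdot\left(\breve{\mathcal M}_p^m\nabla_h\mu_p^{m+1}\right),$$ $$\mu_n^{m+1}=\ln n^{m+1}+(-\Delta_h)^{-1}(n^{m+1}-p^{m+1}),\qquad \mu_p^{m+1}=\ln p^{m+1}+(-\Delta_h)^{-1}(p^{m+1}-n^{m+1}).$$ Then, for every $m\ge0$, $$E_h(n^{m+1},p^{m+1})+\Delta t\left(\left[\breve{\mathcal M}_n^m\nabla_h\mu_n^{m+1},\nabla_h\mu_n^{m+1}\right]+\left[\breve{\mathcal M}_p^m\nabla_h\mu_p^{m+1},\nabla_h\mu_p^{m+1}\right]\right)\le E_h(n^m,p^m),$$ where $$E_h(n,p)=\langle n\ln n+p\ln p,\mathbf 1\rangle+\tfrac12\|n-p\|_{-1,h}^2 .$$ Consequently $E_h(n^m,p^m)\le E_h(n^0,p^0)\le C_0$ for all $m\in\mathbb{N}$, where $C_0>0$ is a constant independent of $h$ (the initial grid data $n^0,p^0$ being obtained from fixed continuum initial data as described in the context).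
   Context: Grid: $\Omega=(-L,L)^3$, uniform spacing $h=2L/N$, cell centers $(x_i,x_j,x_k)$ with $x_i=(i-\frac12)h$. $\mathcal{C}_{\rm per}$ is the space of real cell-centered grid functions $\nu=(\nu_{i,j,k})_{i,j,k\in\mathbb{Z}}$ that are $N$-periodic in each index; $\overline{\nu}=\frac{h^3}{|\Omega|}\sum_{i,j,k=1}^N\nu_{i,j,k}$; $\mathring{\mathcal{C}}_{\rm per}=\{\nu\in\mathcal{C}_{\rm per}:\overline{\nu}=0\}$. Operators: $D_x\nu_{i+1/2,j,k}=\frac1h(\nu_{i+1,j,k}-\nu_{i,j,k})$, $A_x\nu_{i+1/2,j,k}=\frac12(\nu_{i+1,j,k}+\nu_{i,j,k})$, and for face-centered $f$, $d_xf_{i,j,k}=\frac1h(f_{i+1/2,j,k}-f_{i-1/2,j,k})$, $a_xf_{i,j,k}=\frac12(f_{i+1/2,j,k}+f_{i-1/2,j,k})$; similarly for $y$, $z$. $\nabla_h\nu=(D_x\nu,D_y\nu,D_z\nu)$, $\nabla_h\cdot\vec f=d_xf^x+d_yf^y+d_zf^z$, $\Delta_h=\nabla_h\cdot\nabla_h$. A scalar function defined at all face centers multiplies a face-centered vector field pointwise. For $f\in\mathring{\mathcal{C}}_{\rm per}$, $(-\Delta_h)^{-1}f$ is the unique $\psi\in\mathring{\mathcal{C}}_{\rm per}$ with $-\Delta_h\psi=f$. Inner products and norms: $\langle\nu,\xi\rangle=h^3\sum_{i,j,k=1}^N\nu_{i,j,k}\xi_{i,j,k}$; for face-centered vector fields,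 $[\vec f,\vec g]=\langle a_x(f^xg^x),1\rangle+\langle a_y(f^yg^y),1\rangle+\langle a_z(f^zg^z),1\rangle$; $\|f\|_{-1,h}=\sqrt{\langle f,(-\Delta_h)^{-1}f\rangle}$ for $f\in\mathring{\mathcal{C}}_{\rm per}$. Mobilities: $\breve{\mathcal M}_n^m$ is the face-centered function whose values at $x$-, $y$-, $z$-faces are $A_xn^m$, $A_yn^m$, $A_zn^m$; $\breve{\mathcal M}_p^m$ is defined in the same way from $D\,p^m$. Initial data: there are fixed positive, $\Omega$-periodic functions $\mathsf N(\cdot,0),\mathsf P(\cdot,0)\in C^6_{\rm per}(\Omega)$ with equal averages over $\Omega$; $N=2K+1$; and $n^0$, $p^0$ are the values at the cell centers of the Fourier projections of $\mathsf N(\cdot,0)$, $\mathsf P(\cdot,0)$ onto trigonometric polynomials of degree at most $K$ (in each variable), with $h$ such that $n^0,p^0>0$. *)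

theory Defs
  imports "HOL-Analysis.Analysis"
begin

subsection \<open>Grid functions\<close>

text \<open>
  A cell-centered function is indexed by all of \<open>\<int>\<^sup>3\<close>. The components of a triple of type
  \<open>face\<close> are functions on the \<open>x\<close>-, \<open>y\<close>- and \<open>z\<close>-faces, stored by the lower integer index: the entry
  \<open>(i, j, k)\<close> of the first component is the value at \<open>(i + 1/2, j, k)\<close>, that of the second the value
  at \<open>(i, j + 1/2, k)\<close>, and that of the third the value at \<open>(i, j, k + 1/2)\<close>.
\<close>

type_synonym grid = "int \<Rightarrow> int \<Rightarrow> int \<Rightarrow> real"
type_synonym face = "grid \<times> grid \<times> grid"

definition mesh :: "real \<Rightarrow> nat \<Rightarrow> real" where
  "mesh L N = 2 * L / real N"

definition C_per :: "nat \<Rightarrow> grid set" where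
  "C_per N = {\<nu>. \<forall>i j k. \<nu> (i + int N) j k = \<nu> i j k \<and> \<nu> i (j + int N) k = \<nu> i j k
                          \<and> \<nu> i j (k + int N) = \<nu> i j k}"

definition grid_sum :: "nat \<Rightarrow> grid \<Rightarrow> real" where
  "grid_sum N \<nu> = (\<Sum>i\<in>{1..int N}. \<Sum>j\<in>{1..int N}. \<Sum>k\<in>{1..int N}. \<nu> i j k)"

definition grid_mean :: "real \<Rightarrow> nat \<Rightarrow> grid \<Rightarrow> real" where
  "grid_mean L N \<nu> = (mesh L N)^3 / (2 * L)^3 * grid_sum N \<nu>"

definition C_per0 :: "real \<Rightarrow> nat \<Rightarrow> grid set" where
  "C_per0 L N = {\<nu> \<in> C_per N. grid_mean L N \<nu> = 0}"

definition grid_pos :: "grid \<Rightarrow> bool" where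
  "grid_pos \<nu> \<longleftrightarrow> (\<forall>i j k. \<nu> i j k > 0)"

definition grid_diff :: "grid \<Rightarrow> grid \<Rightarrow> grid" where
  "grid_diff \<nu> \<xi> = (\<lambda>i j k. \<nu> i j k - \<xi> i j k)"

subsection \<open>Difference and averaging operators\<close>

definition face_grad :: "real \<Rightarrow> grid \<Rightarrow> face" where
  "face_grad h \<nu> =
     (\<lambda>i j k. (\<nu> (i + 1) j k - \<nu> i j k) / h,
      \<lambda>i j k. (\<nu> i (j + 1) k - \<nu> i j k) / h,
      \<lambda>i j k. (\<nu> i j (k + 1) - \<nu> i j k) / h)"

definition face_avg :: "grid \<Rightarrow> face" where
  "face_avg \<nu> =
     (\<lambda>i j k. (\<nu> (i + 1) j k + \<nu> i j k) / 2,
      \<lambda>i j k. (\<nu> i (j + 1) k + \<nu> i j k) / 2,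
      \<lambda>i j k. (\<nu> i j (k + 1) + \<nu> i j k) / 2)"

definition d_x :: "real \<Rightarrow> grid \<Rightarrow> grid" where
  "d_x h f = (\<lambda>i j k. (f i j k - f (i - 1) j k) / h)"

definition d_y :: "real \<Rightarrow> grid \<Rightarrow> grid" where
  "d_y h f = (\<lambda>i j k. (f i j k - f i (j - 1) k) / h)"

definition d_z :: "real \<Rightarrow> grid \<Rightarrow> grid" where
  "d_z h f = (\<lambda>i j k. (f i j k - f i j (k - 1)) / h)"

definition a_x :: "grid \<Rightarrow> grid" where
  "a_x f = (\<lambda>i j k. (f i j k + f (i - 1) j k) / 2)"

definition a_y :: "grid \<Rightarrow> grid" where
  "a_y f = (\<lambda>i j k. (f i j k + f i (j - 1) k) / 2)"

definition a_z :: "grid \<Rightarrow> grid" where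
  "a_z f = (\<lambda>i j k. (f i j k + f i j (k - 1)) / 2)"

definition face_div :: "real \<Rightarrow> face \<Rightarrow> grid" where
  "face_div h = (\<lambda>(fx, fy, fz) i j k. d_x h fx i j k + d_y h fy i j k + d_z h fz i j k)"

definition face_mult :: "face \<Rightarrow> face \<Rightarrow> face" where
  "face_mult = (\<lambda>(fx, fy, fz) (gx, gy, gz).
     (\<lambda>i j k. fx i j k * gx i j k, \<lambda>i j k. fy i j k * gy i j k, \<lambda>i j k. fz i j k * gz i j k))"

definition lap :: "real \<Rightarrow> grid \<Rightarrow> grid" where
  "lap h \<nu> = face_div h (face_grad h \<nu>)"

definition inv_neg_lap :: "real \<Rightarrow> nat \<Rightarrow> grid \<Rightarrow> grid" where
  "inv_neg_lap L N f =
     (THE \<psi>. \<psi> \<in> C_per0 L N \<and> (\<forall>i j k. - lap (mesh L N) \<psi> i j k = f i j k))"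

subsection \<open>Inner products, norm and discrete energy\<close>

definition grid_inner :: "real \<Rightarrow> nat \<Rightarrow> grid \<Rightarrow> grid \<Rightarrow> real" where
  "grid_inner L N \<nu> \<xi> = (mesh L N)^3 * grid_sum N (\<lambda>i j k. \<nu> i j k * \<xi> i j k)"

definition face_inner :: "real \<Rightarrow> nat \<Rightarrow> face \<Rightarrow> face \<Rightarrow> real" where
  "face_inner L N f g =
     (case face_mult f g of (qx, qy, qz) \<Rightarrow>
        grid_inner L N (a_x qx) (\<lambda>i j k. 1) + grid_inner L N (a_y qy) (\<lambda>i j k. 1)
        + grid_inner L N (a_z qz) (\<lambda>i j k. 1))"

definition norm_neg1 :: "real \<Rightarrow> nat \<Rightarrow> grid \<Rightarrow> real" where
  "norm_neg1 L N f = sqrt (grid_inner L N f (inv_neg_lap L N f))"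

definition energy :: "real \<Rightarrow> nat \<Rightarrow> grid \<Rightarrow> grid \<Rightarrow> real" where
  "energy L N n p =
     grid_inner L N (\<lambda>i j k. n i j k * ln (n i j k) + p i j k * ln (p i j k)) (\<lambda>i j k. 1)
     + (norm_neg1 L N (grid_diff n p))\<^sup>2 / 2"

subsection \<open>The scheme\<close>

definition mobility_n :: "grid \<Rightarrow> face" where
  "mobility_n n = face_avg n"

definition mobility_p :: "real \<Rightarrow> grid \<Rightarrow> face" where
  "mobility_p D p = face_avg (\<lambda>i j k. D * p i j k)"

definition mu_n :: "real \<Rightarrow> nat \<Rightarrow> grid \<Rightarrow> grid \<Rightarrow> grid" where
  "mu_n L N n p = (\<lambda>i j k. ln (n i j k) + inv_neg_lap L N (grid_diff n p) i j k)"

definition mu_p :: "real \<Rightarrow> nat \<Rightarrow> grid \<Rightarrow> grid \<Rightarrow> grid" where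
  "mu_p L N n p = (\<lambda>i j k. ln (p i j k) + inv_neg_lap L N (grid_diff p n) i j k)"

definition numerical_solution ::
  "real \<Rightarrow> nat \<Rightarrow> real \<Rightarrow> real \<Rightarrow> (nat \<Rightarrow> grid) \<Rightarrow> (nat \<Rightarrow> grid) \<Rightarrow> bool" where
  "numerical_solution L N D dt n p \<longleftrightarrow>
     (\<forall>m. n m \<in> C_per N \<and> p m \<in> C_per N \<and> grid_pos (n m) \<and> grid_pos (p m)
          \<and> grid_diff (n m) (p m) \<in> C_per0 L N) \<and>
     (\<forall>m i j k. (n (Suc m) i j k - n m i j k) / dt =
        face_div (mesh L N) (face_mult (mobility_n (n m))
          (face_grad (mesh L N) (mu_n L N (n (Suc m)) (p (Suc m))))) i j k) \<and>
     (\<forall>m i j k. (p (Suc m) i j k - p m i j k) / dt =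
        face_div (mesh L N) (face_mult (mobility_p D (p m))
          (face_grad (mesh L N) (mu_p L N (n (Suc m)) (p (Suc m))))) i j k)"

subsection \<open>Initial data\<close>

type_synonym point = "real \<times> real \<times> real"

definition Omega :: "real \<Rightarrow> point set" where
  "Omega L = box (- L, - L, - L) (L, L, L)"

text \<open>
  \<open>C_diff k f\<close> means that \<open>f\<close> is of class \<open>C\<^sup>k\<close> on the whole space: all directional derivatives of
  order less than \<open>k\<close> are Frechet differentiable, and those of order \<open>k\<close> are continuous.
\<close>

primrec C_diff :: "nat \<Rightarrow> ('a::real_normed_vector \<Rightarrow> real) \<Rightarrow> bool" where
  "C_diff 0 f \<longleftrightarrow> continuous_on UNIV f"
| "C_diff (Suc k) f \<longleftrightarrow>
     (\<forall>x. f differentiable (at x)) \<and> (\<forall>v. C_diff k (\<lambda>x. frechet_derivative f (at x) v))"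

definition Omega_periodic :: "real \<Rightarrow> (point \<Rightarrow> real) \<Rightarrow> bool" where
  "Omega_periodic L f \<longleftrightarrow>
     (\<forall>x y z. f (x + 2 * L, y, z) = f (x, y, z) \<and> f (x, y + 2 * L, z) = f (x, y, z)
              \<and> f (x, y, z + 2 * L) = f (x, y, z))"

definition Omega_average :: "real \<Rightarrow> (point \<Rightarrow> 'b::real_normed_vector) \<Rightarrow> 'b" where
  "Omega_average L f = integral (Omega L) f /\<^sub>R (2 * L)^3"

definition fourier_mode :: "real \<Rightarrow> int \<Rightarrow> int \<Rightarrow> int \<Rightarrow> point \<Rightarrow> complex" where
  "fourier_mode L a b c =
     (\<lambda>(x, y, z). exp (\<i> * of_real (pi / L * (of_int a * x + of_int b * y + of_int c * z))))"

definition fourier_coeff :: "real \<Rightarrow> (point \<Rightarrow> real) \<Rightarrow> int \<Rightarrow> int \<Rightarrow> int \<Rightarrow> complex" where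
  "fourier_coeff L f a b c = Omega_average L (\<lambda>x. of_real (f x) * cnj (fourier_mode L a b c x))"

text \<open>
  The sum below is real, because the coefficients of \<open>f\<close> at opposite frequencies are complex
  conjugates; \<open>Re\<close> only changes the type.
\<close>

definition fourier_proj :: "real \<Rightarrow> nat \<Rightarrow> (point \<Rightarrow> real) \<Rightarrow> point \<Rightarrow> real" where
  "fourier_proj L K f x =
     Re (\<Sum>a\<in>{- int K..int K}. \<Sum>b\<in>{- int K..int K}. \<Sum>c\<in>{- int K..int K}.
           fourier_coeff L f a b c * fourier_mode L a b c x)"

definition cell_values :: "real \<Rightarrow> (point \<Rightarrow> real) \<Rightarrow> grid" where
  "cell_values h f = (\<lambda>i j k. f ((of_int i - 1/2) * h, (of_int j - 1/2) * h, (of_int k - 1/2) * h))"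

definition initial_grid :: "real \<Rightarrow> nat \<Rightarrow> (point \<Rightarrow> real) \<Rightarrow> grid" where
  "initial_grid L K f = cell_values (mesh L (2 * K + 1)) (fourier_proj L K f)"

end

theory Submission
  imports Defs "Jordan_Normal_Form.Determinant"
begin

text \<open>
  Testing the two equations of the scheme with \<open>\<mu>\<^sub>n\<close> and \<open>\<mu>\<^sub>p\<close> and summing by parts turns the mobility terms
  into inner products of increments with chemical potentials, and these dominate the change of the
  energy because both \<open>x ln x\<close> (with mass conserved) and \<open>\<parallel>\<cdot>\<parallel>\<^sub>-\<^sub>1\<^sup>2 / 2\<close> are convex. For the uniform bound on the
  initial energy, \<open>x ln x \<le> x\<^sup>2\<close> and a discrete Poincare inequality with constant \<open>6 L\<^sup>2\<close> reduce the
  matter to the discrete \<open>L\<^sup>2\<close> norms of the Fourier projections; on a grid of \<open>2 K + 1\<close> points these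
  equal the \<open>L\<^sup>2\<close> norms over \<open>\<Omega>\<close>, so Bessel's inequality bounds them by the norms of the continuum data.
\<close>

subsection \<open>Periodic grid functions and summation by parts\<close>

text \<open>The main obstacle is that \<open>inv_neg_lap\<close> is a definite description, so
  nothing can be said about the energy or the potentials until the discrete Poisson problem is known
  to be uniquely solvable. Uniqueness comes from summation by parts and the Poincare inequality,
  existence from uniqueness by finite dimension. The explicit constant in that inequality later
  makes the bound on \<open>norm_neg1\<close> independent of the mesh. The time levels of the scheme
  fit the convexity argument. The potentials sit at the new level, where the derivative of a convex
  functional must be evaluated to bound its increase from above; the mobilities may stay at the old
  level because they enter the dissipation only as nonnegative weights. The initial bound goes
  through L2 because a Fourier projection obeys no maximum principle, whereas it contracts the L2
  norm. The upper bound of x ln x by a square is also insensitive to how close the grid values come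
  to zero.\<close>

lemma periodic_sum_shift:
  fixes u :: "int \<Rightarrow> 'a::comm_monoid_add"
  assumes "\<And>i. u (i + int N) = u i"
  shows "(\<Sum>i\<in>{1..int N}. u (i + 1)) = (\<Sum>i\<in>{1..int N}. u i)"
proof (cases "N = 0")
  case False
  have "(\<Sum>i\<in>{1..int N}. u (i + 1)) = (\<Sum>i\<in>{2..int N + 1}. u i)"
    by (rule sum.reindex_bij_witness[of _ "\<lambda>i. i - 1" "\<lambda>i. i + 1"]) auto
  also have "{2..int N + 1} = insert (int N + 1) {2..int N}"
    using False by auto
  also have "(\<Sum>i\<in>\<dots>. u i) = u (int N + 1) + (\<Sum>i\<in>{2..int N}. u i)"
    by simp
  also have "u (int N + 1) = u 1"
    using assms[of 1] by (simp add: add.commute)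
  also have "u 1 + (\<Sum>i\<in>{2..int N}. u i) = (\<Sum>i\<in>insert 1 {2..int N}. u i)"
    by simp
  also have "insert 1 {2..int N} = {1..int N}"
    using False by auto
  finally show ?thesis .
qed simp

lemma periodic_sum_shift_back:
  fixes u :: "int \<Rightarrow> 'a::comm_monoid_add"
  assumes "\<And>i. u (i + int N) = u i"
  shows "(\<Sum>i\<in>{1..int N}. u (i - 1)) = (\<Sum>i\<in>{1..int N}. u i)"
proof -
  have "u (i + int N - 1) = u (i - 1)" for i
    using assms[of "i - 1"] by (simp add: algebra_simps)
  then show ?thesis
    using periodic_sum_shift[of "\<lambda>i. u (i - 1)" N] by simp
qed

lemma C_perD:
  assumes "\<nu> \<in> C_per N"
  shows "\<nu> (i + int N) j k = \<nu> i j k" "\<nu> i (j + int N) k = \<nu> i j k"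
    "\<nu> i j (k + int N) = \<nu> i j k"
  using assms by (auto simp: C_per_def)

lemma C_per_shift:
  assumes "\<nu> \<in> C_per N"
  shows "(\<lambda>i j k. \<nu> (i + a) (j + b) (k + c)) \<in> C_per N"
proof -
  have swap: "x + int N + y = x + y + int N" for x y
    by simp
  then show ?thesis
    using C_perD[OF assms] by (simp add: C_per_def swap)
qed

lemma C_per_map2:
  assumes "\<nu> \<in> C_per N" "\<xi> \<in> C_per N"
  shows "(\<lambda>i j k. f (\<nu> i j k) (\<xi> i j k)) \<in> C_per N"
  using C_perD[OF assms(1)] C_perD[OF assms(2)] by (simp add: C_per_def)

lemma C_per_map:
  assumes "\<nu> \<in> C_per N"
  shows "(\<lambda>i j k. f (\<nu> i j k)) \<in> C_per N"
  using C_perD[OF assms(1)] by (simp add: C_per_def)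

lemma C_per_mult:
  "\<nu> \<in> C_per N \<Longrightarrow> \<xi> \<in> C_per N \<Longrightarrow> (\<lambda>i j k. \<nu> i j k * \<xi> i j k) \<in> C_per N"
  using C_per_map2[of \<nu> N \<xi> "(*)"] by simp

lemma grid_sum_add:
  "grid_sum N (\<lambda>i j k. \<nu> i j k + \<xi> i j k) = grid_sum N \<nu> + grid_sum N \<xi>"
  by (simp add: grid_sum_def sum.distrib)

lemma grid_sum_diff:
  "grid_sum N (\<lambda>i j k. \<nu> i j k - \<xi> i j k) = grid_sum N \<nu> - grid_sum N \<xi>"
  by (simp add: grid_sum_def sum_subtractf)

lemma grid_sum_cmult: "grid_sum N (\<lambda>i j k. c * \<nu> i j k) = c * grid_sum N \<nu>"
  by (simp add: grid_sum_def sum_distrib_left)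

lemma grid_sum_minus: "grid_sum N (\<lambda>i j k. - \<nu> i j k) = - grid_sum N \<nu>"
  using grid_sum_cmult[of N "-1" \<nu>] by simp

lemma grid_sum_divide: "grid_sum N (\<lambda>i j k. \<nu> i j k / c) = grid_sum N \<nu> / c"
  using grid_sum_cmult[of N "inverse c" \<nu>] by (simp add: divide_inverse mult.commute)

lemma grid_sum_const: "grid_sum N (\<lambda>i j k. c) = real N ^ 3 * c"
  by (simp add: grid_sum_def power3_eq_cube)

lemma grid_sum_mono:
  assumes "\<And>i j k. \<nu> i j k \<le> \<xi> i j k"
  shows "grid_sum N \<nu> \<le> grid_sum N \<xi>"
  unfolding grid_sum_def by (intro sum_mono assms)

lemma grid_sum_nonneg:
  assumes "\<And>i j k. 0 \<le> \<nu> i j k"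
  shows "0 \<le> grid_sum N \<nu>"
  unfolding grid_sum_def by (intro sum_nonneg assms)

lemma grid_sum_shift_back:
  assumes "\<nu> \<in> C_per N"
  shows "grid_sum N (\<lambda>i j k. \<nu> (i - 1) j k) = grid_sum N \<nu>"
    "grid_sum N (\<lambda>i j k. \<nu> i (j - 1) k) = grid_sum N \<nu>"
    "grid_sum N (\<lambda>i j k. \<nu> i j (k - 1)) = grid_sum N \<nu>"
proof -
  show "grid_sum N (\<lambda>i j k. \<nu> (i - 1) j k) = grid_sum N \<nu>"
    using periodic_sum_shift_back[of "\<lambda>i. \<Sum>j\<in>{1..int N}. \<Sum>k\<in>{1..int N}. \<nu> i j k" N]
    by (simp add: grid_sum_def C_perD[OF assms])
  show "grid_sum N (\<lambda>i j k. \<nu> i (j - 1) k) = grid_sum N \<nu>"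
    using periodic_sum_shift_back[of "\<lambda>j. \<Sum>k\<in>{1..int N}. \<nu> _ j k" N]
    by (simp add: grid_sum_def C_perD[OF assms])
  show "grid_sum N (\<lambda>i j k. \<nu> i j (k - 1)) = grid_sum N \<nu>"
    using periodic_sum_shift_back[of "\<lambda>k. \<nu> _ _ k" N]
    by (simp add: grid_sum_def C_perD[OF assms])
qed

text \<open>By the product rule the two summands add up to a difference quotient of consecutive
  values of one periodic function, \<open>f i j k * \<phi> (i + 1) j k\<close> in the first
  direction, and such a difference sums to zero over a period.\<close>

lemma summation_by_parts_aux:
  assumes "f \<in> C_per N" "\<phi> \<in> C_per N"
  shows "grid_sum N (\<lambda>i j k. d_x h f i j k * \<phi> i j k)
           = - grid_sum N (\<lambda>i j k. f i j k * ((\<phi> (i + 1) j k - \<phi> i j k) / h))" (is ?x)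
    and "grid_sum N (\<lambda>i j k. d_y h f i j k * \<phi> i j k)
           = - grid_sum N (\<lambda>i j k. f i j k * ((\<phi> i (j + 1) k - \<phi> i j k) / h))" (is ?y)
    and "grid_sum N (\<lambda>i j k. d_z h f i j k * \<phi> i j k)
           = - grid_sum N (\<lambda>i j k. f i j k * ((\<phi> i j (k + 1) - \<phi> i j k) / h))" (is ?z)
proof -
  have per: "(\<lambda>i j k. f i j k * \<phi> (i + 1) j k) \<in> C_per N"
    "(\<lambda>i j k. f i j k * \<phi> i (j + 1) k) \<in> C_per N"
    "(\<lambda>i j k. f i j k * \<phi> i j (k + 1)) \<in> C_per N"
    using C_per_mult[OF assms(1) C_per_shift[OF assms(2), of 1 0 0]]
      C_per_mult[OF assms(1) C_per_shift[OF assms(2), of 0 1 0]]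
      C_per_mult[OF assms(1) C_per_shift[OF assms(2), of 0 0 1]] by simp_all
  have "grid_sum N (\<lambda>i j k. d_x h f i j k * \<phi> i j k + f i j k * ((\<phi> (i + 1) j k - \<phi> i j k) / h))
    = grid_sum N (\<lambda>i j k. (f i j k * \<phi> (i + 1) j k - f (i - 1) j k * \<phi> i j k) / h)"
    by (intro arg_cong[of _ _ "grid_sum N"] ext) (simp add: d_x_def field_simps flip: add_divide_distrib)
  also have "\<dots> = 0"
    using grid_sum_shift_back(1)[OF per(1)] by (simp add: grid_sum_divide grid_sum_diff)
  finally show ?x by (simp add: grid_sum_add)
  have "grid_sum N (\<lambda>i j k. d_y h f i j k * \<phi> i j k + f i j k * ((\<phi> i (j + 1) k - \<phi> i j k) / h))
    = grid_sum N (\<lambda>i j k. (f i j k * \<phi> i (j + 1) k - f i (j - 1) k * \<phi> i j k) / h)"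
    by (intro arg_cong[of _ _ "grid_sum N"] ext) (simp add: d_y_def field_simps flip: add_divide_distrib)
  also have "\<dots> = 0"
    using grid_sum_shift_back(2)[OF per(2)] by (simp add: grid_sum_divide grid_sum_diff)
  finally show ?y by (simp add: grid_sum_add)
  have "grid_sum N (\<lambda>i j k. d_z h f i j k * \<phi> i j k + f i j k * ((\<phi> i j (k + 1) - \<phi> i j k) / h))
    = grid_sum N (\<lambda>i j k. (f i j k * \<phi> i j (k + 1) - f i j (k - 1) * \<phi> i j k) / h)"
    by (intro arg_cong[of _ _ "grid_sum N"] ext) (simp add: d_z_def field_simps flip: add_divide_distrib)
  also have "\<dots> = 0"
    using grid_sum_shift_back(3)[OF per(3)] by (simp add: grid_sum_divide grid_sum_diff)
  finally show ?z by (simp add: grid_sum_add)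
qed

abbreviation face_per :: "nat \<Rightarrow> face set" where
  "face_per N \<equiv> C_per N \<times> C_per N \<times> C_per N"

lemma face_per_grad: "\<nu> \<in> C_per N \<Longrightarrow> face_grad h \<nu> \<in> face_per N"
  using C_per_map2[OF C_per_shift[of \<nu> N 1 0 0], of \<nu> "\<lambda>x y. (x - y) / h"]
    C_per_map2[OF C_per_shift[of \<nu> N 0 1 0], of \<nu> "\<lambda>x y. (x - y) / h"]
    C_per_map2[OF C_per_shift[of \<nu> N 0 0 1], of \<nu> "\<lambda>x y. (x - y) / h"]
  by (simp add: face_grad_def)

lemma face_per_avg: "\<nu> \<in> C_per N \<Longrightarrow> face_avg \<nu> \<in> face_per N"
  using C_per_map2[OF C_per_shift[of \<nu> N 1 0 0], of \<nu> "\<lambda>x y. (x + y) / 2"]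
    C_per_map2[OF C_per_shift[of \<nu> N 0 1 0], of \<nu> "\<lambda>x y. (x + y) / 2"]
    C_per_map2[OF C_per_shift[of \<nu> N 0 0 1], of \<nu> "\<lambda>x y. (x + y) / 2"]
  by (simp add: face_avg_def)

lemma face_per_mult:
  "f \<in> face_per N \<Longrightarrow> g \<in> face_per N \<Longrightarrow> face_mult f g \<in> face_per N"
  by (auto simp: face_mult_def C_per_mult)

text \<open>A face value enters the averages of its two adjacent cells with weight 1/2 each, so by
  periodicity the averaging operators leave the total sum unchanged.\<close>

lemma face_inner_eq:
  assumes "f \<in> face_per N" "g \<in> face_per N"
  shows "face_inner L N f g = (mesh L N)^3 *
    (grid_sum N (\<lambda>i j k. fst f i j k * fst g i j k)
     + grid_sum N (\<lambda>i j k. fst (snd f) i j k * fst (snd g) i j k)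
     + grid_sum N (\<lambda>i j k. snd (snd f) i j k * snd (snd g) i j k))"
proof -
  have avg: "grid_sum N (\<lambda>i j k. a_x \<nu> i j k) = grid_sum N \<nu>"
    "grid_sum N (\<lambda>i j k. a_y \<nu> i j k) = grid_sum N \<nu>"
    "grid_sum N (\<lambda>i j k. a_z \<nu> i j k) = grid_sum N \<nu>" if "\<nu> \<in> C_per N" for \<nu>
    using grid_sum_shift_back[OF that]
    by (simp_all add: a_x_def a_y_def a_z_def grid_sum_divide grid_sum_add)
  obtain fx fy fz gx gy gz where fg: "f = (fx, fy, fz)" "g = (gx, gy, gz)"
    by (metis prod.exhaust)
  have "(\<lambda>i j k. fx i j k * gx i j k) \<in> C_per N" "(\<lambda>i j k. fy i j k * gy i j k) \<in> C_per N"
    "(\<lambda>i j k. fz i j k * gz i j k) \<in> C_per N"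
    using assms by (auto simp: fg C_per_mult)
  then show ?thesis
    by (simp add: fg face_inner_def face_mult_def grid_inner_def avg distrib_left)
qed

lemma summation_by_parts:
  assumes "f \<in> face_per N" "\<phi> \<in> C_per N"
  shows "grid_inner L N (face_div h f) \<phi> = - face_inner L N f (face_grad h \<phi>)"
proof -
  obtain fx fy fz where f: "f = (fx, fy, fz)"
    by (metis prod.exhaust)
  then have "fx \<in> C_per N" "fy \<in> C_per N" "fz \<in> C_per N"
    using assms by auto
  then show ?thesis
    unfolding face_inner_eq[OF assms(1) face_per_grad[OF assms(2)]]
    using summation_by_parts_aux[OF _ assms(2)]
    by (simp add: f face_div_def face_grad_def grid_inner_def distrib_right grid_sum_add algebra_simps)
qed

subsection \<open>The discrete Poincare inequality\<close>

text \<open>Telescoping and Cauchy-Schwarz. A path inside one period has fewer than \<open>N\<close>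
  increments, and enlarging the sum to the whole period makes the bound independent of the
  endpoints.\<close>

lemma square_diff_le_sum_increments:
  fixes u :: "int \<Rightarrow> real"
  assumes "a \<in> {1..int N}" "b \<in> {1..int N}"
  shows "(u a - u b)\<^sup>2 \<le> real N * (\<Sum>l\<in>{1..int N}. (u (l + 1) - u l)\<^sup>2)"
proof -
  have *: "(u b - u a)\<^sup>2 \<le> real N * (\<Sum>l\<in>{1..int N}. (u (l + 1) - u l)\<^sup>2)"
    if "a \<le> b" "1 \<le> a" "b \<le> int N" for a b
  proof -
    have "u b - u a = (\<Sum>l\<in>{a..<b}. u (l + 1) - u l)"
      using that(1)
    proof (induction b rule: int_ge_induct)
      case (step b)
      then have "{a..<b + 1} = insert b {a..<b}" by auto
      with step show ?case by simp
    qed simp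
    then have "(u b - u a)\<^sup>2 \<le> (\<Sum>l\<in>{a..<b}. (u (l + 1) - u l)\<^sup>2) * card {a..<b}"
      using sum_squared_le_sum_of_squares[of _ "{a..<b}"] by simp
    also have "\<dots> \<le> (\<Sum>l\<in>{1..int N}. (u (l + 1) - u l)\<^sup>2) * real N"
      using that by (intro mult_mono sum_mono2 sum_nonneg) auto
    finally show ?thesis by (simp add: mult.commute)
  qed
  show ?thesis
    using *[of a b] *[of b a] assms by (cases "a \<le> b") (auto simp: power2_commute)
qed

lemma square_sum3_le: "(x + y + z)\<^sup>2 \<le> 3 * (x\<^sup>2 + y\<^sup>2 + z\<^sup>2)" for x y z :: real
proof -
  have "0 \<le> (x - y)\<^sup>2 + (y - z)\<^sup>2 + (x - z)\<^sup>2"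
    by simp
  then show ?thesis
    by (simp add: power2_eq_square algebra_simps)
qed

text \<open>The sum of \<open>(\<psi> P - \<psi> Q)\<^sup>2\<close> over all pairs of grid points is
  estimated in two ways. Expanding the square gives \<open>2 * real N ^ 3\<close> times the sum of
  squares, as the mixed term vanishes for mean zero; joining each pair by an axis-parallel path
  bounds it by increments.\<close>

lemma discrete_Poincare_increments:
  assumes "grid_sum N \<psi> = 0"
  shows "2 * grid_sum N (\<lambda>i j k. (\<psi> i j k)\<^sup>2) \<le> 3 * (real N)\<^sup>2 *
    (grid_sum N (\<lambda>i j k. (\<psi> (i + 1) j k - \<psi> i j k)\<^sup>2)
     + grid_sum N (\<lambda>i j k. (\<psi> i (j + 1) k - \<psi> i j k)\<^sup>2)
     + grid_sum N (\<lambda>i j k. (\<psi> i j (k + 1) - \<psi> i j k)\<^sup>2))"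
    (is "2 * ?Q \<le> _ * (?X + ?Y + ?Z)")
proof -
  \<comment> \<open>Each of these is a sum along a full grid line and depends on only two of the six
    indices of a pair; summing over the other four yields the factors \<open>real N ^ 4\<close>
    below.\<close>
  define gx where "gx j k = (\<Sum>l\<in>{1..int N}. (\<psi> (l + 1) j k - \<psi> l j k)\<^sup>2)" for j k
  define gy where "gy i k = (\<Sum>l\<in>{1..int N}. (\<psi> i (l + 1) k - \<psi> i l k)\<^sup>2)" for i k
  define gz where "gz i j = (\<Sum>l\<in>{1..int N}. (\<psi> i j (l + 1) - \<psi> i j l)\<^sup>2)" for i j
  have X: "(\<Sum>j\<in>{1..int N}. \<Sum>k\<in>{1..int N}. gx j k) = ?X"
  proof -
    have "(\<Sum>j\<in>{1..int N}. \<Sum>k\<in>{1..int N}. gx j k) = (\<Sum>j\<in>{1..int N}. \<Sum>l\<in>{1..int N}.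
        \<Sum>k\<in>{1..int N}. (\<psi> (l + 1) j k - \<psi> l j k)\<^sup>2)"
      unfolding gx_def by (intro sum.cong refl sum.swap)
    also have "\<dots> = ?X"
      unfolding grid_sum_def by (rule sum.swap)
    finally show ?thesis .
  qed
  have Y: "(\<Sum>k\<in>{1..int N}. \<Sum>i\<in>{1..int N}. gy i k) = ?Y"
  proof -
    have "(\<Sum>k\<in>{1..int N}. \<Sum>i\<in>{1..int N}. gy i k) = (\<Sum>i\<in>{1..int N}. \<Sum>k\<in>{1..int N}. gy i k)"
      by (rule sum.swap)
    also have "\<dots> = ?Y"
      unfolding grid_sum_def gy_def by (intro sum.cong refl sum.swap)
    finally show ?thesis .
  qed
  have Z: "(\<Sum>i\<in>{1..int N}. \<Sum>j\<in>{1..int N}. gz i j) = ?Z"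
    by (simp add: gz_def grid_sum_def)
  \<comment> \<open>The path changes the first coordinate, then the second, then the third, which
    explains the mixture of primed and unprimed indices.\<close>
  have pair: "(\<psi> i j k - \<psi> i' j' k')\<^sup>2 \<le> 3 * real N * (gx j k + gy i' k + gz i' j')"
    if "i \<in> {1..int N}" "j \<in> {1..int N}" "k \<in> {1..int N}"
      "i' \<in> {1..int N}" "j' \<in> {1..int N}" "k' \<in> {1..int N}" for i j k i' j' k'
  proof -
    have "(\<psi> i j k - \<psi> i' j' k')\<^sup>2 =
      ((\<psi> i j k - \<psi> i' j k) + (\<psi> i' j k - \<psi> i' j' k) + (\<psi> i' j' k - \<psi> i' j' k'))\<^sup>2"
      by simp
    also have "\<dots> \<le> 3 * ((\<psi> i j k - \<psi> i' j k)\<^sup>2 + (\<psi> i' j k - \<psi> i' j' k)\<^sup>2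
        + (\<psi> i' j' k - \<psi> i' j' k')\<^sup>2)"
      by (rule square_sum3_le)
    also have "\<dots> \<le> 3 * (real N * gx j k + real N * gy i' k + real N * gz i' j')"
      unfolding gx_def gy_def gz_def using that
      by (intro mult_left_mono add_mono square_diff_le_sum_increments[where u = "\<lambda>i. \<psi> i _ _"]
          square_diff_le_sum_increments[where u = "\<lambda>j. \<psi> _ j _"]
          square_diff_le_sum_increments[where u = "\<lambda>k. \<psi> _ _ k"]) auto
    finally show ?thesis by (simp add: algebra_simps)
  qed
  have "grid_sum N (\<lambda>i j k. grid_sum N (\<lambda>i' j' k'. (\<psi> i j k - \<psi> i' j' k')\<^sup>2))
    \<le> grid_sum N (\<lambda>i j k. grid_sum N (\<lambda>i' j' k'. 3 * real N * (gx j k + gy i' k + gz i' j')))"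
    unfolding grid_sum_def by (intro sum_mono pair)
  also have "\<dots> = 3 * real N * (grid_sum N (\<lambda>i j k. grid_sum N (\<lambda>i' j' k'. gx j k))
      + grid_sum N (\<lambda>i j k. grid_sum N (\<lambda>i' j' k'. gy i' k))
      + grid_sum N (\<lambda>i j k. grid_sum N (\<lambda>i' j' k'. gz i' j')))"
    by (simp only: grid_sum_cmult grid_sum_add)
  also have "grid_sum N (\<lambda>i j k. grid_sum N (\<lambda>i' j' k'. gx j k)) = real N ^ 4 * ?X"
    unfolding X[symmetric]
    by (simp add: grid_sum_def sum_distrib_left[symmetric] power_numeral_reduce mult.assoc)
  also have "grid_sum N (\<lambda>i j k. grid_sum N (\<lambda>i' j' k'. gy i' k)) = real N ^ 4 * ?Y"
    unfolding Y[symmetric]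
    by (simp add: grid_sum_def sum_distrib_left[symmetric] power_numeral_reduce mult.assoc)
  also have "grid_sum N (\<lambda>i j k. grid_sum N (\<lambda>i' j' k'. gz i' j')) = real N ^ 4 * ?Z"
    unfolding Z[symmetric]
    by (simp add: grid_sum_def sum_distrib_left[symmetric] power_numeral_reduce mult.assoc)
  finally have upper: "grid_sum N (\<lambda>i j k. grid_sum N (\<lambda>i' j' k'. (\<psi> i j k - \<psi> i' j' k')\<^sup>2))
    \<le> 3 * real N ^ 5 * (?X + ?Y + ?Z)"
    by (simp add: power_numeral_reduce algebra_simps)
  have "grid_sum N (\<lambda>i' j' k'. (\<psi> i j k - \<psi> i' j' k')\<^sup>2) = real N ^ 3 * (\<psi> i j k)\<^sup>2 + ?Q" for i j k
  proof -
    have "grid_sum N (\<lambda>i' j' k'. (\<psi> i j k - \<psi> i' j' k')\<^sup>2)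
      = grid_sum N (\<lambda>i' j' k'. (\<psi> i j k)\<^sup>2 - 2 * \<psi> i j k * \<psi> i' j' k' + (\<psi> i' j' k')\<^sup>2)"
      by (simp add: power2_diff algebra_simps)
    also have "\<dots> = real N ^ 3 * (\<psi> i j k)\<^sup>2 + ?Q"
      by (simp only: assms grid_sum_add grid_sum_diff grid_sum_cmult grid_sum_const)
    finally show ?thesis .
  qed
  then have "grid_sum N (\<lambda>i j k. grid_sum N (\<lambda>i' j' k'. (\<psi> i j k - \<psi> i' j' k')\<^sup>2)) = 2 * real N ^ 3 * ?Q"
    by (simp only: grid_sum_add grid_sum_cmult grid_sum_const)
  with upper have "real N ^ 3 * (2 * ?Q) \<le> real N ^ 3 * (3 * (real N)\<^sup>2 * (?X + ?Y + ?Z))"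
    by (simp add: power_numeral_reduce algebra_simps)
  then show ?thesis
    by (cases "N = 0") (auto simp: grid_sum_def)
qed

text \<open>Increments are the mesh size times gradient components and \<open>N\<close> times the
  mesh size is \<open>2 * L\<close>, so the constant is (3/2) (2 L)^2 = 6 L^2, whatever
  \<open>N\<close> is.\<close>

lemma discrete_Poincare:
  assumes "L > 0" "N \<ge> 1" "\<psi> \<in> C_per0 L N"
  shows "grid_inner L N \<psi> \<psi>
    \<le> 6 * L\<^sup>2 * face_inner L N (face_grad (mesh L N) \<psi>) (face_grad (mesh L N) \<psi>)"
proof -
  have h: "mesh L N > 0" "real N * mesh L N = 2 * L"
    using assms by (auto simp: mesh_def)
  have \<psi>: "\<psi> \<in> C_per N" "grid_sum N \<psi> = 0"
    using assms h(1) by (auto simp: C_per0_def grid_mean_def)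
  let ?X = "grid_sum N (\<lambda>i j k. (\<psi> (i + 1) j k - \<psi> i j k)\<^sup>2)"
  let ?Y = "grid_sum N (\<lambda>i j k. (\<psi> i (j + 1) k - \<psi> i j k)\<^sup>2)"
  let ?Z = "grid_sum N (\<lambda>i j k. (\<psi> i j (k + 1) - \<psi> i j k)\<^sup>2)"
  have "face_inner L N (face_grad (mesh L N) \<psi>) (face_grad (mesh L N) \<psi>)
      = (mesh L N)^3 * ((?X + ?Y + ?Z) / (mesh L N)\<^sup>2)"
    unfolding face_inner_eq[OF face_per_grad face_per_grad, OF \<psi>(1) \<psi>(1)]
    by (simp add: face_grad_def grid_sum_divide add_divide_distrib power_divide flip: power2_eq_square)
  moreover have "grid_inner L N \<psi> \<psi> = (mesh L N)^3 * grid_sum N (\<lambda>i j k. (\<psi> i j k)\<^sup>2)"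
    by (simp add: grid_inner_def power2_eq_square)
  moreover have "grid_sum N (\<lambda>i j k. (\<psi> i j k)\<^sup>2) \<le> 6 * L\<^sup>2 * ((?X + ?Y + ?Z) / (mesh L N)\<^sup>2)"
  proof -
    have "(real N)\<^sup>2 = 4 * L\<^sup>2 / (mesh L N)\<^sup>2"
      using h by (simp add: field_simps flip: power_mult_distrib)
    then show ?thesis
      using discrete_Poincare_increments[OF \<psi>(2)] by simp
  qed
  ultimately show ?thesis
    using h(1) by (simp only: mult.left_commute[of "6 * L\<^sup>2" "mesh L N ^ 3"]) (rule mult_left_mono, simp_all)
qed

subsection \<open>The inverse discrete Laplacian\<close>

text \<open>An enumeration \<open>e\<close> of \<open>S\<close> turns the system into a square
  matrix; a trivial kernel gives a nonzero determinant, hence a right inverse.\<close>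

lemma injective_imp_solvable:
  fixes A :: "'a \<Rightarrow> 'a \<Rightarrow> 'b::field"
  assumes "finite S"
    and inj: "\<And>x. (\<And>s. s \<in> S \<Longrightarrow> (\<Sum>t\<in>S. A s t * x t) = 0) \<Longrightarrow> (\<And>s. s \<in> S \<Longrightarrow> x s = 0)"
  shows "\<exists>x. \<forall>s\<in>S. (\<Sum>t\<in>S. A s t * x t) = b s"
proof -
  define n where "n = card S"
  obtain e where e: "bij_betw e {0..<n} S"
    using ex_bij_betw_nat_finite[OF \<open>finite S\<close>] n_def by blast
  define M where "M = mat n n (\<lambda>(i, j). A (e i) (e j))"
  define r where "r = inv_into {0..<n} e"
  have M: "M \<in> carrier_mat n n"
    by (simp add: M_def)
  have r: "r (e i) = i" if "i < n" for i
    using e that by (simp add: r_def bij_betw_def)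
  have row: "(M *\<^sub>v v) $ i = (\<Sum>t\<in>S. A (e i) t * v $ r t)" if "i < n" "v \<in> carrier_vec n" for v i
  proof -
    have "(M *\<^sub>v v) $ i = (\<Sum>j\<in>{0..<n}. A (e i) (e j) * v $ r (e j))"
      using that by (simp add: M_def scalar_prod_def r)
    also have "\<dots> = (\<Sum>t\<in>S. A (e i) t * v $ r t)"
      by (rule sum.reindex_bij_betw[OF e])
    finally show ?thesis .
  qed
  have "det M \<noteq> 0"
  proof
    assume "det M = 0"
    then obtain v where v: "v \<in> carrier_vec n" "v \<noteq> 0\<^sub>v n" "M *\<^sub>v v = 0\<^sub>v n"
      using det_0_iff_vec_prod_zero_field[OF M] by blast
    have "(\<Sum>t\<in>S. A s t * v $ r t) = 0" if "s \<in> S" for s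
    proof -
      obtain i where "i < n" "s = e i"
        using e \<open>s \<in> S\<close> by (auto simp: bij_betw_def)
      then show ?thesis
        using row[of i v] v by simp
    qed
    then have "v $ r s = 0" if "s \<in> S" for s
      using inj[of "\<lambda>t. v $ r t"] that by blast
    then have "v $ i = 0" if "i < n" for i
      using that r[of i] e by (metis atLeastLessThan_iff bij_betw_apply zero_le)
    with v show False by (auto intro!: eq_vecI)
  qed
  then obtain B where B: "B \<in> carrier_mat n n" "M * B = 1\<^sub>m n"
    using det_non_zero_imp_unit[OF M, of "()"] by (auto simp: Units_def ring_mat_def)
  define v where "v = B *\<^sub>v vec n (\<lambda>i. b (e i))"
  have v: "v \<in> carrier_vec n"
    using B by (simp add: v_def)
  have "M *\<^sub>v v = vec n (\<lambda>i. b (e i))"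
    unfolding v_def using M B by (simp flip: assoc_mult_mat_vec)
  then have "(\<Sum>t\<in>S. A (e i) t * v $ r t) = b (e i)" if "i < n" for i
    using row[OF that v] that by simp
  then have "\<forall>s\<in>S. (\<Sum>t\<in>S. A s t * v $ r t) = b s"
    using e by (auto simp: bij_betw_def)
  then show ?thesis
    by (intro exI[of _ "\<lambda>t. v $ r t"])
qed

text \<open>Although \<open>T\<close> acts on all functions, only inputs supported in
  \<open>S\<close> and outputs restricted to \<open>S\<close> matter. The columns of its matrix are
  the images of the indicator functions of points of \<open>S\<close>.\<close>

lemma linear_injective_imp_surjective_on:
  fixes T :: "('a \<Rightarrow> 'b::field) \<Rightarrow> 'a \<Rightarrow> 'b"
  assumes S: "finite S"
    and add: "\<And>x y. T (\<lambda>t. x t + y t) = (\<lambda>s. T x s + T y s)"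
    and scale: "\<And>c x. T (\<lambda>t. c * x t) = (\<lambda>s. c * T x s)"
    and inj: "\<And>x. (\<And>t. t \<notin> S \<Longrightarrow> x t = 0) \<Longrightarrow> (\<And>s. s \<in> S \<Longrightarrow> T x s = 0) \<Longrightarrow> x = (\<lambda>_. 0)"
  shows "\<exists>x. \<forall>s\<in>S. T x s = b s"
proof -
  define A where "A s t = T (\<lambda>u. if u = t then 1 else 0) s" for s t
  have T0: "T (\<lambda>_. 0) = (\<lambda>_. 0)"
    using scale[of 0 "\<lambda>_. 0"] by simp
  \<comment> \<open>Additivity is given for two summands only, so the expansion in indicator
    functions is obtained by induction on the support.\<close>
  have T: "T (\<lambda>u. if u \<in> F then x u else 0) s = (\<Sum>t\<in>F. A s t * x t)" if "finite F" for F x s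
    using that
  proof induction
    case (insert t F)
    have "(\<lambda>u. if u \<in> insert t F then x u else 0)
        = (\<lambda>u. x t * (if u = t then 1 else 0) + (if u \<in> F then x u else 0))"
      using insert.hyps by auto
    then have "T (\<lambda>u. if u \<in> insert t F then x u else 0) s
        = x t * A s t + T (\<lambda>u. if u \<in> F then x u else 0) s"
      by (simp only: add scale A_def)
    then show ?case
      using insert by simp
  qed (simp add: T0)
  have "\<exists>x. \<forall>s\<in>S. (\<Sum>t\<in>S. A s t * x t) = b s"
  proof (rule injective_imp_solvable[OF S])
    fix x s
    assume "\<And>s. s \<in> S \<Longrightarrow> (\<Sum>t\<in>S. A s t * x t) = 0" and s: "s \<in> S"
    then have "(\<lambda>u. if u \<in> S then x u else 0) = (\<lambda>_. 0)"
      using T[OF S] by (intro inj) auto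
    from fun_cong[OF this, of s] s show "x s = 0" by simp
  qed
  then show ?thesis
    unfolding T[OF S, symmetric] by (elim exE) (rule exI)
qed

lemma C_per_const: "(\<lambda>i j k. c) \<in> C_per N"
  by (simp add: C_per_def)

lemma C_per_face_div:
  assumes "f \<in> face_per N"
  shows "face_div h f \<in> C_per N"
proof -
  obtain fx fy fz where f: "f = (fx, fy, fz)"
    by (metis prod.exhaust)
  then have "fx \<in> C_per N" "fy \<in> C_per N" "fz \<in> C_per N"
    using assms by auto
  then have "d_x h fx \<in> C_per N" "d_y h fy \<in> C_per N" "d_z h fz \<in> C_per N"
    using C_per_map2[OF _ C_per_shift[of fx N "-1" 0 0], of fx "\<lambda>x y. (x - y) / h"]
      C_per_map2[OF _ C_per_shift[of fy N 0 "-1" 0], of fy "\<lambda>x y. (x - y) / h"]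
      C_per_map2[OF _ C_per_shift[of fz N 0 0 "-1"], of fz "\<lambda>x y. (x - y) / h"]
    by (simp_all add: d_x_def d_y_def d_z_def)
  then show ?thesis
    by (simp add: f face_div_def C_per_def)
qed

lemma C_per_lap: "\<psi> \<in> C_per N \<Longrightarrow> lap h \<psi> \<in> C_per N"
  unfolding lap_def by (intro C_per_face_div face_per_grad)

text \<open>Summation by parts against the constant 1, whose gradient vanishes. It yields
  conservation of mass in the scheme as well as the mean-zero range of the discrete
  Laplacian.\<close>

lemma grid_sum_face_div:
  assumes "f \<in> face_per N"
  shows "grid_sum N (face_div h f) = 0"
proof -
  obtain fx fy fz where f: "f = (fx, fy, fz)"
    by (metis prod.exhaust)
  then have "fx \<in> C_per N" "fy \<in> C_per N" "fz \<in> C_per N"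
    using assms by auto
  then show ?thesis
    using summation_by_parts_aux[OF _ C_per_const, of _ N h 1]
    by (simp add: f face_div_def grid_sum_add grid_sum_const)
qed

lemma C_per0_iff:
  assumes "L > 0" "N \<ge> 1"
  shows "\<nu> \<in> C_per0 L N \<longleftrightarrow> \<nu> \<in> C_per N \<and> grid_sum N \<nu> = 0"
  using assms by (auto simp: C_per0_def grid_mean_def mesh_def)

section \<open>Reduction of periodic grid functions to one period\<close>

text \<open>The representative of \<open>i\<close> modulo \<open>N\<close>; the two unit shifts
  adapt \<open>mod\<close>, whose range starts at 0, to cells numbered from 1.\<close>

definition wrap :: "nat \<Rightarrow> int \<Rightarrow> int" where
  "wrap N i = (i - 1) mod int N + 1"

lemma wrap_in:
  assumes "N \<ge> 1"
  shows "wrap N i \<in> {1..int N}"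
proof -
  have "0 \<le> (i - 1) mod int N" "(i - 1) mod int N < int N"
    using assms by simp_all
  then show ?thesis by (simp add: wrap_def)
qed

lemma wrap_id: "i \<in> {1..int N} \<Longrightarrow> wrap N i = i"
  by (auto simp: wrap_def)

lemma wrap_add: "wrap N (i + int N) = wrap N i"
proof -
  have "i + int N - 1 = i - 1 + int N" by simp
  then show ?thesis by (simp only: wrap_def mod_add_self2)
qed

lemma periodic_wrap:
  fixes u :: "int \<Rightarrow> 'a"
  assumes "\<And>i. u (i + int N) = u i"
  shows "u (wrap N i) = u i"
proof -
  \<comment> \<open>The multiple \<open>m\<close> will be a quotient that may be negative, hence the
    induction in both directions.\<close>
  have *: "u (i + m * int N) = u i" for i m
  proof (induction m rule: int_induct[where k = 0])
    case (step1 m)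
    then show ?case
      using assms[of "i + m * int N"] by (simp add: algebra_simps)
  next
    case (step2 m)
    then show ?case
      using assms[of "i + (m - 1) * int N"] by (simp add: algebra_simps)
  qed simp
  have "i = wrap N i + (i - 1) div int N * int N"
    using div_mult_mod_eq[of "i - 1" "int N"] unfolding wrap_def by linarith
  then show ?thesis
    using *[of "wrap N i" "(i - 1) div int N"] by simp
qed

lemma C_per_wrap:
  assumes "\<nu> \<in> C_per N"
  shows "\<nu> (wrap N i) (wrap N j) (wrap N k) = \<nu> i j k"
proof -
  have "\<nu> (wrap N i) (wrap N j) (wrap N k) = \<nu> i (wrap N j) (wrap N k)"
    using periodic_wrap[of "\<lambda>i. \<nu> i (wrap N j) (wrap N k)"] C_perD[OF assms] by simp
  also have "\<dots> = \<nu> i j (wrap N k)"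
    using periodic_wrap[of "\<lambda>j. \<nu> i j (wrap N k)"] C_perD[OF assms] by simp
  also have "\<dots> = \<nu> i j k"
    using periodic_wrap[of "\<lambda>k. \<nu> i j k"] C_perD[OF assms] by simp
  finally show ?thesis .
qed

lemma C_per_eqI:
  assumes "N \<ge> 1" "\<nu> \<in> C_per N" "\<xi> \<in> C_per N"
    and "\<And>i j k. i \<in> {1..int N} \<Longrightarrow> j \<in> {1..int N} \<Longrightarrow> k \<in> {1..int N} \<Longrightarrow> \<nu> i j k = \<xi> i j k"
  shows "\<nu> = \<xi>"
proof (intro ext)
  fix i j k
  show "\<nu> i j k = \<xi> i j k"
    using assms(4)[OF wrap_in wrap_in wrap_in, OF assms(1) assms(1) assms(1), of i j k]
    by (simp only: C_per_wrap[OF assms(2)] C_per_wrap[OF assms(3)])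
qed

section \<open>Kernel and range of the discrete Laplacian\<close>

lemma grid_inner_self_le_0:
  assumes "L > 0" "N \<ge> 1" "\<psi> \<in> C_per N" "grid_inner L N \<psi> \<psi> \<le> 0"
  shows "\<psi> = (\<lambda>i j k. 0)"
proof (rule C_per_eqI[OF assms(2,3) C_per_const])
  fix i j k
  assume ijk: "i \<in> {1..int N}" "j \<in> {1..int N}" "k \<in> {1..int N}"
  have "mesh L N > 0"
    using assms by (simp add: mesh_def)
  then have "grid_sum N (\<lambda>i j k. \<psi> i j k * \<psi> i j k) \<le> 0"
    using assms(4) by (simp add: grid_inner_def mult_le_0_iff)
  then have "grid_sum N (\<lambda>i j k. \<psi> i j k * \<psi> i j k) = 0"
    by (intro antisym grid_sum_nonneg) simp_all
  then show "\<psi> i j k = 0"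
    using ijk by (simp add: grid_sum_def sum_nonneg_eq_0_iff sum_nonneg)
qed

lemma lap_add: "lap h (\<lambda>i j k. \<psi> i j k + \<phi> i j k) = (\<lambda>i j k. lap h \<psi> i j k + lap h \<phi> i j k)"
  by (intro ext) (simp add: lap_def face_div_def face_grad_def d_x_def d_y_def d_z_def
      add_divide_distrib diff_divide_distrib)

lemma lap_cmult: "lap h (\<lambda>i j k. c * \<psi> i j k) = (\<lambda>i j k. c * lap h \<psi> i j k)"
  by (intro ext) (simp add: lap_def face_div_def face_grad_def d_x_def d_y_def d_z_def
      add_divide_distrib diff_divide_distrib right_diff_distrib distrib_left)

lemma discrete_Green:
  assumes "\<psi> \<in> C_per N" "\<phi> \<in> C_per N"
  shows "grid_inner L N (\<lambda>i j k. - lap h \<psi> i j k) \<phi>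
    = face_inner L N (face_grad h \<psi>) (face_grad h \<phi>)"
  using summation_by_parts[OF face_per_grad[OF assms(1)] assms(2), of L h h]
  by (simp add: lap_def grid_inner_def grid_sum_minus)

text \<open>Green's formula makes the gradient vanish in norm, and the Poincare inequality then
  leaves no room for a nonzero mean-zero function.\<close>

lemma neg_lap_kernel:
  assumes "L > 0" "N \<ge> 1" "\<psi> \<in> C_per0 L N" "\<And>i j k. lap (mesh L N) \<psi> i j k = 0"
  shows "\<psi> = (\<lambda>i j k. 0)"
proof -
  have \<psi>: "\<psi> \<in> C_per N"
    using assms C_per0_iff by blast
  have "face_inner L N (face_grad (mesh L N) \<psi>) (face_grad (mesh L N) \<psi>) = 0"
    using discrete_Green[OF \<psi> \<psi>, of L "mesh L N"] assms(4)
    by (simp add: grid_inner_def grid_sum_const)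
  then show ?thesis
    using discrete_Poincare[OF assms(1-3)] grid_inner_self_le_0[OF assms(1,2) \<psi>] by simp
qed

text \<open>
  \<open>\<psi> \<mapsto> - \<Delta>\<^sub>h \<psi> + \<Sum> \<psi>\<close> is injective on all periodic grid functions, hence bijective by finite
  dimension, and for a mean-zero right-hand side its solutions have mean zero and solve \<open>- \<Delta>\<^sub>h \<psi> = f\<close>.
\<close>

lemma neg_lap_surj:
  assumes "L > 0" "N \<ge> 1" "f \<in> C_per0 L N"
  shows "\<exists>\<psi>\<in>C_per0 L N. \<forall>i j k. - lap (mesh L N) \<psi> i j k = f i j k"
proof -
  define S where "S = {1..int N} \<times> {1..int N} \<times> {1..int N}"
  \<comment> \<open>The unknowns are the values on one period \<open>S\<close>; \<open>ext\<close>
    turns them into a periodic grid function.\<close>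
  define ext where "ext x = (\<lambda>i j k. x (wrap N i, wrap N j, wrap N k))" for x :: "int \<times> int \<times> int \<Rightarrow> real"
  \<comment> \<open>Adding the total sum removes the constants from the kernel, so the problem can
    be posed for arbitrary values on \<open>S\<close> instead of on a subspace.\<close>
  define B where "B \<psi> = (\<lambda>i j k. - lap (mesh L N) \<psi> i j k + grid_sum N \<psi>)" for \<psi>
  have ext_per: "ext x \<in> C_per N" for x
    by (simp add: ext_def C_per_def wrap_add)
  have B_per: "B \<psi> \<in> C_per N" if "\<psi> \<in> C_per N" for \<psi>
    using C_per_map[OF C_per_lap[OF that], of "\<lambda>x. - x + grid_sum N \<psi>"] by (simp add: B_def)
  have B_sum: "grid_sum N (B \<psi>) = real N ^ 3 * grid_sum N \<psi>" if "\<psi> \<in> C_per N" for \<psi>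
    using grid_sum_face_div[OF face_per_grad[OF that]]
    by (simp add: B_def grid_sum_diff grid_sum_const lap_def)
  \<comment> \<open>Summing \<open>B \<psi> = g\<close> over the grid kills the Laplacian and leaves
    \<open>real N ^ 3 * grid_sum N \<psi> = 0\<close>. This serves twice, with \<open>g = 0\<close>
    for injectivity and with \<open>g = f\<close> for the solution.\<close>
  have B_solution: "\<psi> \<in> C_per0 L N" "\<And>i j k. - lap (mesh L N) \<psi> i j k = g i j k"
    if "\<psi> \<in> C_per N" "B \<psi> = g" "grid_sum N g = 0" for \<psi> g
  proof -
    have "grid_sum N \<psi> = 0"
      using B_sum[OF that(1)] that(2,3) assms by simp
    then show "\<psi> \<in> C_per0 L N" "\<And>i j k. - lap (mesh L N) \<psi> i j k = g i j k"
      using that assms by (auto simp: C_per0_iff B_def)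
  qed
  have "\<exists>x. \<forall>s\<in>S. (\<lambda>(i, j, k). B (ext x) i j k) s = (\<lambda>(i, j, k). f i j k) s"
  proof (rule linear_injective_imp_surjective_on)
    show "finite S" by (simp add: S_def)
    show "(\<lambda>(i, j, k). B (ext (\<lambda>t. x t + y t)) i j k)
        = (\<lambda>s. (\<lambda>(i, j, k). B (ext x) i j k) s + (\<lambda>(i, j, k). B (ext y) i j k) s)" for x y
      by (auto simp: B_def ext_def lap_add grid_sum_add)
    show "(\<lambda>(i, j, k). B (ext (\<lambda>t. c * x t)) i j k)
        = (\<lambda>s. c * (\<lambda>(i, j, k). B (ext x) i j k) s)" for c x
      by (simp add: fun_eq_iff B_def ext_def lap_cmult grid_sum_cmult algebra_simps)
  next
    fix x :: "int \<times> int \<times> int \<Rightarrow> real"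
    assume x: "\<And>t. t \<notin> S \<Longrightarrow> x t = 0"
      and Bx: "\<And>s. s \<in> S \<Longrightarrow> (\<lambda>(i, j, k). B (ext x) i j k) s = 0"
    have "B (ext x) = (\<lambda>i j k. 0)"
      using Bx by (intro C_per_eqI[OF assms(2) B_per[OF ext_per] C_per_const]) (auto simp: S_def)
    from B_solution[OF ext_per this] have "ext x = (\<lambda>i j k. 0)"
      by (intro neg_lap_kernel[OF assms(1,2)]) (simp_all add: grid_sum_const)
    then have "ext x i j k = 0" for i j k
      by simp
    then have "x (i, j, k) = 0" if "(i, j, k) \<in> S" for i j k
      using that unfolding ext_def S_def by (metis SigmaD1 SigmaD2 wrap_id)
    with x show "x = (\<lambda>_. 0)"
      by (metis prod_cases3)
  qed
  then obtain x where "\<forall>s\<in>S. (\<lambda>(i, j, k). B (ext x) i j k) s = (\<lambda>(i, j, k). f i j k) s" ..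
  then have x: "B (ext x) i j k = f i j k" if "(i, j, k) \<in> S" for i j k
    using that by (auto dest: bspec)
  have f: "f \<in> C_per N" "grid_sum N f = 0"
    using assms C_per0_iff by blast+
  have "B (ext x) = f"
    using x by (intro C_per_eqI[OF assms(2) B_per[OF ext_per] f(1)]) (auto simp: S_def)
  from B_solution[OF ext_per this f(2)] show ?thesis
    by blast
qed

lemma inv_neg_lap_eqI:
  assumes "L > 0" "N \<ge> 1" "\<psi> \<in> C_per0 L N" "\<And>i j k. - lap (mesh L N) \<psi> i j k = f i j k"
  shows "inv_neg_lap L N f = \<psi>"
  unfolding inv_neg_lap_def
proof (rule the_equality)
  fix \<phi> assume \<phi>: "\<phi> \<in> C_per0 L N \<and> (\<forall>i j k. - lap (mesh L N) \<phi> i j k = f i j k)"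
  \<comment> \<open>The difference is written as a sum with a multiple so that
    \<open>lap_add\<close> and \<open>lap_cmult\<close> apply literally.\<close>
  let ?d = "\<lambda>i j k. \<phi> i j k + - 1 * \<psi> i j k"
  have "?d = (\<lambda>i j k. 0)"
  proof (rule neg_lap_kernel[OF assms(1,2)])
    have "?d \<in> C_per N"
      using \<phi> assms C_per_map2[of \<phi> N \<psi> "\<lambda>x y. x + - 1 * y"] by (simp add: C_per0_iff)
    then show "?d \<in> C_per0 L N"
      using \<phi> assms by (simp add: C_per0_iff grid_sum_diff)
    show "lap (mesh L N) ?d i j k = 0" for i j k
      using \<phi> assms(4)[of i j k] unfolding lap_add lap_cmult by (simp add: minus_equation_iff)
  qed
  then show "\<phi> = \<psi>"
    by (simp add: fun_eq_iff)
qed (use assms in blast)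

lemma inv_neg_lap:
  assumes "L > 0" "N \<ge> 1" "f \<in> C_per0 L N"
  shows "inv_neg_lap L N f \<in> C_per0 L N" "- lap (mesh L N) (inv_neg_lap L N f) i j k = f i j k"
  using neg_lap_surj[OF assms] inv_neg_lap_eqI[OF assms(1,2)] by metis+

text \<open>With this, both chemical potentials involve the same electrostatic potential, with
  opposite signs.\<close>

lemma inv_neg_lap_minus:
  assumes "L > 0" "N \<ge> 1" "grid_diff n p \<in> C_per0 L N"
  shows "inv_neg_lap L N (grid_diff p n) = (\<lambda>i j k. - inv_neg_lap L N (grid_diff n p) i j k)"
proof (rule inv_neg_lap_eqI[OF assms(1,2)])
  let ?\<psi> = "inv_neg_lap L N (grid_diff n p)"
  note \<psi> = inv_neg_lap[OF assms]
  show "(\<lambda>i j k. - ?\<psi> i j k) \<in> C_per0 L N"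
    using \<psi>(1) assms(1,2) C_per_map[of ?\<psi> N uminus] by (simp add: C_per0_iff grid_sum_minus)
  show "- lap (mesh L N) (\<lambda>i j k. - ?\<psi> i j k) i j k = grid_diff p n i j k" for i j k
    using \<psi>(2)[of i j k] lap_cmult[of "mesh L N" "- 1" ?\<psi>] by (simp add: grid_diff_def)
qed

subsection \<open>Energy dissipation\<close>

lemma C_per0_imp_C_per: "f \<in> C_per0 L N \<Longrightarrow> f \<in> C_per N"
  by (simp add: C_per0_def)

text \<open>Pairings with \<open>f\<close> become gradient inner products, from which positivity,
  symmetry and convexity of the negative norm can be read off.\<close>

lemma grid_inner_inv_neg_lap:
  assumes "L > 0" "N \<ge> 1" "f \<in> C_per0 L N" "\<phi> \<in> C_per N"
  shows "grid_inner L N f \<phi>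
    = face_inner L N (face_grad (mesh L N) (inv_neg_lap L N f)) (face_grad (mesh L N) \<phi>)"
proof -
  note \<psi> = inv_neg_lap[OF assms(1-3)]
  then show ?thesis
    using discrete_Green[OF C_per0_imp_C_per[OF \<psi>(1)] assms(4), of L "mesh L N"] by simp
qed

lemma face_inner_self_nonneg:
  assumes "L > 0" "f \<in> face_per N"
  shows "0 \<le> face_inner L N f f"
  unfolding face_inner_eq[OF assms(2,2)] using assms(1)
  by (intro mult_nonneg_nonneg[of "mesh L N ^ 3"] add_nonneg_nonneg grid_sum_nonneg)
    (simp_all add: mesh_def)

lemma face_inner_le_half:
  assumes "L > 0" "f \<in> face_per N" "g \<in> face_per N"
  shows "face_inner L N f g \<le> (face_inner L N f f + face_inner L N g g) / 2"
proof -
  have *: "grid_sum N (\<lambda>i j k. u i j k * v i j k)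
      \<le> (grid_sum N (\<lambda>i j k. u i j k * u i j k) + grid_sum N (\<lambda>i j k. v i j k * v i j k)) / 2" for u v
    unfolding grid_sum_add[symmetric] grid_sum_divide[symmetric]
  proof (rule grid_sum_mono)
    fix i j k
    have "0 \<le> (u i j k - v i j k)\<^sup>2" by simp
    then show "u i j k * v i j k \<le> (u i j k * u i j k + v i j k * v i j k) / 2"
      by (simp add: power2_eq_square algebra_simps)
  qed
  let ?s = "\<lambda>f g. grid_sum N (\<lambda>i j k. fst f i j k * fst g i j k)
     + grid_sum N (\<lambda>i j k. fst (snd f) i j k * fst (snd g) i j k)
     + grid_sum N (\<lambda>i j k. snd (snd f) i j k * snd (snd g) i j k)"
  have "?s f g \<le> (?s f f + ?s g g) / 2"
    using *[of "fst f" "fst g"] *[of "fst (snd f)" "fst (snd g)"] *[of "snd (snd f)" "snd (snd g)"]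
    by argo
  then have "(mesh L N)^3 * ?s f g \<le> (mesh L N)^3 * ((?s f f + ?s g g) / 2)"
    using assms(1) by (intro mult_left_mono) (simp_all add: mesh_def)
  then show ?thesis
    unfolding face_inner_eq[OF assms(2,2)] face_inner_eq[OF assms(3,3)] face_inner_eq[OF assms(2,3)]
    by argo
qed

text \<open>Squaring undoes \<open>sqrt\<close> because the radicand is nonnegative: it is the
  squared gradient norm of the potential.\<close>

lemma norm_neg1_sq:
  assumes "L > 0" "N \<ge> 1" "f \<in> C_per0 L N"
  shows "(norm_neg1 L N f)\<^sup>2 = grid_inner L N f (inv_neg_lap L N f)"
proof -
  have "inv_neg_lap L N f \<in> C_per N"
    using inv_neg_lap[OF assms] by (simp add: C_per0_def)
  then show ?thesis
    unfolding norm_neg1_def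
    using grid_inner_inv_neg_lap[OF assms] face_inner_self_nonneg[OF assms(1) face_per_grad] by simp
qed

text \<open>In terms of the gradients a, b of the two potentials the claim is |b|^2/2 - |a|^2/2
  \<le> |b|^2 - a.b, which is Young's inequality.\<close>

lemma norm_neg1_convex:
  assumes "L > 0" "N \<ge> 1" "f \<in> C_per0 L N" "g \<in> C_per0 L N"
  shows "(norm_neg1 L N g)\<^sup>2 / 2 - (norm_neg1 L N f)\<^sup>2 / 2
    \<le> grid_inner L N g (inv_neg_lap L N g) - grid_inner L N f (inv_neg_lap L N g)"
proof -
  have per: "inv_neg_lap L N f \<in> C_per N" "inv_neg_lap L N g \<in> C_per N"
    using inv_neg_lap(1)[OF assms(1,2)] assms(3,4) by (auto simp: C_per0_def)
  show ?thesis
    using face_inner_le_half[OF assms(1) face_per_grad[OF per(1)] face_per_grad[OF per(2)], of "mesh L N" "mesh L N"]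
    unfolding norm_neg1_sq[OF assms(1-3)] norm_neg1_sq[OF assms(1,2,4)]
      grid_inner_inv_neg_lap[OF assms(1-3) per(1)] grid_inner_inv_neg_lap[OF assms(1-3) per(2)]
      grid_inner_inv_neg_lap[OF assms(1,2,4) per(2)]
    by argo
qed

text \<open>Young's inequality weighted with the Poincare constant \<open>c\<close>: the term in
  \<open>\<psi>\<close> is then at most half of the left-hand side and can be absorbed
  there.\<close>

lemma norm_neg1_le:
  assumes "L > 0" "N \<ge> 1" "f \<in> C_per0 L N"
  shows "(norm_neg1 L N f)\<^sup>2 \<le> 6 * L\<^sup>2 * grid_inner L N f f"
proof -
  define \<psi> where "\<psi> = inv_neg_lap L N f"
  define c where "c = 6 * L\<^sup>2"
  have c: "c > 0"
    using assms by (simp add: c_def)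
  have \<psi>: "\<psi> \<in> C_per0 L N" "\<psi> \<in> C_per N"
    using inv_neg_lap[OF assms] by (auto simp: \<psi>_def C_per0_def)
  have G: "grid_inner L N f \<psi> = face_inner L N (face_grad (mesh L N) \<psi>) (face_grad (mesh L N) \<psi>)"
    using grid_inner_inv_neg_lap[OF assms \<psi>(2)] by (simp add: \<psi>_def)
  have "grid_sum N (\<lambda>i j k. f i j k * \<psi> i j k)
      \<le> grid_sum N (\<lambda>i j k. (c / 2) * (f i j k * f i j k) + (1 / (2 * c)) * (\<psi> i j k * \<psi> i j k))"
  proof (rule grid_sum_mono)
    fix i j k
    have "0 \<le> (c * f i j k - \<psi> i j k)\<^sup>2 / (2 * c)"
      using c by simp
    also have "\<dots> = (c / 2) * (f i j k * f i j k) + (1 / (2 * c)) * (\<psi> i j k * \<psi> i j k) - f i j k * \<psi> i j k"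
      using c by (simp add: field_simps power2_eq_square)
    finally show "f i j k * \<psi> i j k \<le> (c / 2) * (f i j k * f i j k) + (1 / (2 * c)) * (\<psi> i j k * \<psi> i j k)"
      by simp
  qed
  then have "(mesh L N)^3 * grid_sum N (\<lambda>i j k. f i j k * \<psi> i j k) \<le> (mesh L N)^3 *
      ((c / 2) * grid_sum N (\<lambda>i j k. f i j k * f i j k) + (1 / (2 * c)) * grid_sum N (\<lambda>i j k. \<psi> i j k * \<psi> i j k))"
    unfolding grid_sum_add grid_sum_cmult using assms(1)
    by (intro mult_left_mono) (simp_all add: mesh_def)
  then have "grid_inner L N f \<psi> \<le> (c / 2) * grid_inner L N f f + (1 / (2 * c)) * grid_inner L N \<psi> \<psi>"
    by (simp add: grid_inner_def algebra_simps)
  also have "(1 / (2 * c)) * grid_inner L N \<psi> \<psi> \<le> (1 / (2 * c)) * (c * grid_inner L N f \<psi>)"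
    using discrete_Poincare[OF assms(1,2) \<psi>(1)] c by (intro mult_left_mono) (simp_all add: G c_def)
  also have "\<dots> = grid_inner L N f \<psi> / 2"
    using c by simp
  finally show ?thesis
    unfolding norm_neg1_sq[OF assms] by (simp add: \<psi>_def c_def)
qed

section \<open>Convexity of the energy and one time step\<close>

text \<open>The tangent is taken at the new value \<open>b\<close>, matching the implicit logarithm
  of the scheme. Rearranged, this is \<open>ln (b / a) \<le> b / a - 1\<close> multiplied by
  \<open>a\<close>.\<close>

lemma xlnx_convex:
  fixes a b :: real
  assumes "a > 0" "b > 0"
  shows "b * ln b - a * ln a \<le> (b - a) * (ln b + 1)"
proof -
  have "a * ln (b / a) \<le> a * (b / a - 1)"
    using assms by (intro mult_left_mono ln_le_minus_one) auto
  also have "\<dots> = b - a"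
    using assms by (simp add: field_simps)
  finally show ?thesis
    using assms by (simp add: ln_div algebra_simps)
qed

lemma energy_convex:
  assumes "L > 0" "N \<ge> 1" "grid_pos n" "grid_pos p" "grid_pos n'" "grid_pos p'"
    and f: "grid_diff n p \<in> C_per0 L N" and f': "grid_diff n' p' \<in> C_per0 L N"
    and "grid_sum N n' = grid_sum N n" "grid_sum N p' = grid_sum N p"
  shows "energy L N n' p' - energy L N n p
    \<le> grid_inner L N (grid_diff n' n) (mu_n L N n' p') + grid_inner L N (grid_diff p' p) (mu_p L N n' p')"
proof -
  define \<psi> where "\<psi> = inv_neg_lap L N (grid_diff n' p')"
  have h: "mesh L N ^ 3 > 0"
    using assms by (simp add: mesh_def)
  let ?l = "\<lambda>n p i j k. n i j k * ln (n i j k) + p i j k * ln (p i j k) :: real"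
  have "grid_sum N (\<lambda>i j k. ?l n' p' i j k - ?l n p i j k)
    \<le> grid_sum N (\<lambda>i j k. (grid_diff n' n i j k * ln (n' i j k) + grid_diff p' p i j k * ln (p' i j k))
        + ((n' i j k - n i j k) + (p' i j k - p i j k)))"
  proof (rule grid_sum_mono)
    fix i j k
    show "?l n' p' i j k - ?l n p i j k
      \<le> (grid_diff n' n i j k * ln (n' i j k) + grid_diff p' p i j k * ln (p' i j k))
        + ((n' i j k - n i j k) + (p' i j k - p i j k))"
      using xlnx_convex[of "n i j k" "n' i j k"] xlnx_convex[of "p i j k" "p' i j k"] assms(3-6)
      by (simp add: grid_pos_def grid_diff_def algebra_simps)
  qed
  \<comment> \<open>The summand 1 in the derivative of x ln x contributes only the changes of total
    mass, which are zero.\<close>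
  also have "\<dots> = grid_sum N (\<lambda>i j k. grid_diff n' n i j k * ln (n' i j k) + grid_diff p' p i j k * ln (p' i j k))"
    unfolding grid_sum_add[of N _ "\<lambda>i j k. (n' i j k - n i j k) + (p' i j k - p i j k)"]
      grid_sum_add[of N "\<lambda>i j k. n' i j k - n i j k"]
    using assms by (simp add: grid_sum_diff)
  finally have entropy: "mesh L N ^ 3 * grid_sum N (?l n' p') - mesh L N ^ 3 * grid_sum N (?l n p)
    \<le> mesh L N ^ 3 * grid_sum N (\<lambda>i j k. grid_diff n' n i j k * ln (n' i j k) + grid_diff p' p i j k * ln (p' i j k))"
    using h by (simp add: grid_sum_diff flip: right_diff_distrib)
  have "(norm_neg1 L N (grid_diff n' p'))\<^sup>2 / 2 - (norm_neg1 L N (grid_diff n p))\<^sup>2 / 2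
    \<le> grid_inner L N (grid_diff n' p') \<psi> - grid_inner L N (grid_diff n p) \<psi>"
    using norm_neg1_convex[OF assms(1,2) f f'] by (simp add: \<psi>_def)
  \<comment> \<open>The increment of \<open>n - p\<close> is regrouped into the increments of
    \<open>n\<close> and of \<open>p\<close>; the minus sign is the one that \<open>\<psi>\<close>
    carries in \<open>mu_p\<close>.\<close>
  also have "\<dots> = mesh L N ^ 3 * grid_sum N (\<lambda>i j k. grid_diff n' n i j k * \<psi> i j k - grid_diff p' p i j k * \<psi> i j k)"
    unfolding grid_inner_def right_diff_distrib[symmetric] grid_sum_diff[symmetric]
    by (simp add: grid_diff_def algebra_simps)
  finally have electric: "(norm_neg1 L N (grid_diff n' p'))\<^sup>2 / 2 - (norm_neg1 L N (grid_diff n p))\<^sup>2 / 2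
    \<le> mesh L N ^ 3 * grid_sum N (\<lambda>i j k. grid_diff n' n i j k * \<psi> i j k - grid_diff p' p i j k * \<psi> i j k)" .
  have "grid_inner L N (grid_diff n' n) (mu_n L N n' p') + grid_inner L N (grid_diff p' p) (mu_p L N n' p')
    = mesh L N ^ 3 * grid_sum N (\<lambda>i j k. grid_diff n' n i j k * ln (n' i j k) + grid_diff p' p i j k * ln (p' i j k))
     + mesh L N ^ 3 * grid_sum N (\<lambda>i j k. grid_diff n' n i j k * \<psi> i j k - grid_diff p' p i j k * \<psi> i j k)"
    unfolding grid_inner_def mu_n_def mu_p_def inv_neg_lap_minus[OF assms(1,2) f'] \<psi>_def[symmetric]
      distrib_left[symmetric] grid_sum_add[symmetric]
    by (simp add: algebra_simps)
  with entropy electric show ?thesis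
    by (simp add: energy_def grid_inner_def)
qed

text \<open>Stated for an arbitrary face mobility \<open>M\<close> and potential
  \<open>\<mu>\<close>, so that it serves both species.\<close>

lemma implicit_step:
  assumes "dt \<noteq> 0" "M \<in> face_per N" "\<mu> \<in> C_per N"
    and step: "\<And>i j k. (u' i j k - u i j k) / dt = face_div (mesh L N) (face_mult M (face_grad (mesh L N) \<mu>)) i j k"
  shows "grid_sum N u' = grid_sum N u"
    and "grid_inner L N (grid_diff u' u) \<mu>
      = - dt * face_inner L N (face_mult M (face_grad (mesh L N) \<mu>)) (face_grad (mesh L N) \<mu>)"
proof -
  let ?F = "face_mult M (face_grad (mesh L N) \<mu>)"
  have F: "?F \<in> face_per N"
    using assms(2,3) by (intro face_per_mult face_per_grad)
  have diff: "grid_diff u' u = (\<lambda>i j k. dt * face_div (mesh L N) ?F i j k)"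
    using assms(1) by (intro ext) (simp add: grid_diff_def flip: step)
  show "grid_sum N u' = grid_sum N u"
    using grid_sum_cmult[of N dt "face_div (mesh L N) ?F"] grid_sum_face_div[OF F]
    by (simp add: grid_diff_def grid_sum_diff flip: diff)
  have "grid_inner L N (grid_diff u' u) \<mu> = dt * grid_inner L N (face_div (mesh L N) ?F) \<mu>"
    by (simp add: diff grid_inner_def mult.assoc grid_sum_cmult)
  also have "\<dots> = - dt * face_inner L N ?F (face_grad (mesh L N) \<mu>)"
    using summation_by_parts[OF F assms(3)] by simp
  finally show "grid_inner L N (grid_diff u' u) \<mu>
      = - dt * face_inner L N ?F (face_grad (mesh L N) \<mu>)" .
qed

lemma C_per_mu:
  assumes "L > 0" "N \<ge> 1" "n \<in> C_per N" "p \<in> C_per N" "grid_diff n p \<in> C_per0 L N"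
  shows "mu_n L N n p \<in> C_per N" "mu_p L N n p \<in> C_per N"
proof -
  have \<psi>: "inv_neg_lap L N (grid_diff n p) \<in> C_per N"
    using inv_neg_lap(1)[OF assms(1,2,5)] by (simp add: C_per0_def)
  show "mu_n L N n p \<in> C_per N" "mu_p L N n p \<in> C_per N"
    using C_per_map2[OF assms(3) \<psi>, of "\<lambda>x y. ln x + y"] C_per_map2[OF assms(4) \<psi>, of "\<lambda>x y. ln x - y"]
    by (simp_all add: mu_n_def mu_p_def inv_neg_lap_minus[OF assms(1,2,5)])
qed

lemma energy_dissipation:
  assumes "L > 0" "N \<ge> 1" "dt > 0" and sol: "numerical_solution L N D dt n p"
  defines "g m \<equiv> face_grad (mesh L N) (mu_n L N (n (Suc m)) (p (Suc m)))"
    and "q m \<equiv> face_grad (mesh L N) (mu_p L N (n (Suc m)) (p (Suc m)))"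
  shows "energy L N (n (Suc m)) (p (Suc m))
    + dt * (face_inner L N (face_mult (mobility_n (n m)) (g m)) (g m)
            + face_inner L N (face_mult (mobility_p D (p m)) (q m)) (q m))
    \<le> energy L N (n m) (p m)"
proof -
  have sol_m: "n m \<in> C_per N" "p m \<in> C_per N" "grid_pos (n m)" "grid_pos (p m)"
      "grid_diff (n m) (p m) \<in> C_per0 L N"
    and step: "\<And>i j k. (n (Suc m) i j k - n m i j k) / dt =
        face_div (mesh L N) (face_mult (mobility_n (n m)) (g m)) i j k"
      "\<And>i j k. (p (Suc m) i j k - p m i j k) / dt =
        face_div (mesh L N) (face_mult (mobility_p D (p m)) (q m)) i j k" for m
    using sol unfolding numerical_solution_def g_def q_def by blast+
  note \<mu> = C_per_mu[OF assms(1,2) sol_m(1,2,5), of "Suc m"]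
  have M: "mobility_n (n m) \<in> face_per N" "mobility_p D (p m) \<in> face_per N"
    using face_per_avg[OF sol_m(1)] face_per_avg[OF C_per_map[OF sol_m(2), of "\<lambda>x. D * x"]]
    by (simp_all add: mobility_n_def mobility_p_def)
  have "dt \<noteq> 0" using assms by simp
  note steps = implicit_step[OF this M(1) \<mu>(1) step(1)[unfolded g_def]]
    implicit_step[OF \<open>dt \<noteq> 0\<close> M(2) \<mu>(2) step(2)[unfolded q_def]]
  have "energy L N (n (Suc m)) (p (Suc m)) - energy L N (n m) (p m)
    \<le> grid_inner L N (grid_diff (n (Suc m)) (n m)) (mu_n L N (n (Suc m)) (p (Suc m)))
      + grid_inner L N (grid_diff (p (Suc m)) (p m)) (mu_p L N (n (Suc m)) (p (Suc m)))"
    by (rule energy_convex[OF assms(1,2)]) (use sol_m steps in auto)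
  then show ?thesis
    unfolding steps g_def q_def by (simp add: distrib_left)
qed

lemma energy_decreasing:
  assumes "L > 0" "N \<ge> 1" "dt > 0" "D > 0" and sol: "numerical_solution L N D dt n p"
  shows "energy L N (n m) (p m) \<le> energy L N (n 0) (p 0)"
proof (induction m)
  case (Suc m)
  \<comment> \<open>Averages of nonnegative values are nonnegative, so every summand is such a
    weight times a square.\<close>
  have nonneg: "0 \<le> face_inner L N (face_mult (face_avg u) g) g"
    if "u \<in> C_per N" "\<And>i j k. 0 \<le> u i j k" "g \<in> face_per N" for u g
  proof -
    obtain gx gy gz where g: "g = (gx, gy, gz)"
      by (metis prod.exhaust)
    show ?thesis
      unfolding face_inner_eq[OF face_per_mult[OF face_per_avg[OF that(1)] that(3)] that(3)]
      using assms(1) that(2)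
      by (intro mult_nonneg_nonneg[of "mesh L N ^ 3"] add_nonneg_nonneg grid_sum_nonneg)
        (simp_all add: g mesh_def face_mult_def face_avg_def mult.assoc)
  qed
  have sol_m: "n m \<in> C_per N" "p m \<in> C_per N" "\<And>i j k. 0 \<le> n m i j k" "\<And>i j k. 0 \<le> p m i j k"
      "grid_diff (n m) (p m) \<in> C_per0 L N" for m
    using sol by (auto simp: numerical_solution_def grid_pos_def intro: less_imp_le)
  note \<mu> = C_per_mu[OF assms(1,2) sol_m(1,2,5), of "Suc m"]
  let ?g = "face_grad (mesh L N) (mu_n L N (n (Suc m)) (p (Suc m)))"
  let ?q = "face_grad (mesh L N) (mu_p L N (n (Suc m)) (p (Suc m)))"
  have "0 \<le> face_inner L N (face_mult (mobility_n (n m)) ?g) ?g"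
    unfolding mobility_n_def by (rule nonneg[OF sol_m(1,3) face_per_grad[OF \<mu>(1)]])
  moreover have "0 \<le> face_inner L N (face_mult (mobility_p D (p m)) ?q) ?q"
    unfolding mobility_p_def
  proof (rule nonneg[OF _ _ face_per_grad[OF \<mu>(2)]])
    show "(\<lambda>i j k. D * p m i j k) \<in> C_per N"
      using C_per_map[OF sol_m(2), of "\<lambda>x. D * x"] .
    show "0 \<le> D * p m i j k" for i j k
      using sol_m(4) assms(4) by simp
  qed
  ultimately have "0 \<le> dt * (face_inner L N (face_mult (mobility_n (n m)) ?g) ?g
      + face_inner L N (face_mult (mobility_p D (p m)) ?q) ?q)"
    using assms(3) by simp
  then have "energy L N (n (Suc m)) (p (Suc m)) \<le> energy L N (n m) (p m)"
    using energy_dissipation[OF assms(1-3) sol, of m] by linarith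
  with Suc show ?case by simp
qed simp

section \<open>Bounding the energy by discrete L2 norms\<close>

text \<open>The 1 in the constant comes from the entropy through \<open>ln x \<le> x\<close>. The
  rest comes from \<open>norm_neg1_le\<close> and
  \<open>(n - p)\<^sup>2 \<le> 2 * (n\<^sup>2 + p\<^sup>2)\<close>, whose factor 2 cancels the 1/2
  in the energy.\<close>

lemma energy_le:
  assumes "L > 0" "N \<ge> 1" "grid_pos n" "grid_pos p" "grid_diff n p \<in> C_per0 L N"
  shows "energy L N n p \<le> (1 + 6 * L\<^sup>2) * (grid_inner L N n n + grid_inner L N p p)"
proof -
  have h: "mesh L N ^ 3 > 0"
    using assms by (simp add: mesh_def)
  have "grid_sum N (\<lambda>i j k. n i j k * ln (n i j k) + p i j k * ln (p i j k))
    \<le> grid_sum N (\<lambda>i j k. n i j k * n i j k + p i j k * p i j k)"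
  proof (intro grid_sum_mono add_mono mult_left_mono)
    fix i j k
    have "0 < n i j k" "0 < p i j k"
      using assms by (simp_all add: grid_pos_def)
    then show "ln (n i j k) \<le> n i j k" "0 \<le> n i j k" "ln (p i j k) \<le> p i j k" "0 \<le> p i j k"
      using ln_le_minus_one[of "n i j k"] ln_le_minus_one[of "p i j k"] by simp_all
  qed
  then have entropy: "grid_inner L N (\<lambda>i j k. n i j k * ln (n i j k) + p i j k * ln (p i j k)) (\<lambda>i j k. 1)
    \<le> grid_inner L N n n + grid_inner L N p p"
    using h by (simp add: grid_inner_def grid_sum_add flip: distrib_left)
  have "grid_sum N (\<lambda>i j k. grid_diff n p i j k * grid_diff n p i j k)
    \<le> grid_sum N (\<lambda>i j k. 2 * (n i j k * n i j k + p i j k * p i j k))"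
  proof (rule grid_sum_mono)
    fix i j k
    have "0 \<le> (n i j k + p i j k)\<^sup>2" by simp
    then show "grid_diff n p i j k * grid_diff n p i j k \<le> 2 * (n i j k * n i j k + p i j k * p i j k)"
      by (simp add: grid_diff_def power2_eq_square algebra_simps)
  qed
  then have "mesh L N ^ 3 * grid_sum N (\<lambda>i j k. grid_diff n p i j k * grid_diff n p i j k)
      \<le> mesh L N ^ 3 * (2 * (grid_sum N (\<lambda>i j k. n i j k * n i j k) + grid_sum N (\<lambda>i j k. p i j k * p i j k)))"
    unfolding grid_sum_cmult grid_sum_add using h by (intro mult_left_mono) simp_all
  then have "grid_inner L N (grid_diff n p) (grid_diff n p) \<le> 2 * (grid_inner L N n n + grid_inner L N p p)"
    by (simp add: grid_inner_def algebra_simps)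
  then have "6 * L\<^sup>2 * grid_inner L N (grid_diff n p) (grid_diff n p)
      \<le> 6 * L\<^sup>2 * (2 * (grid_inner L N n n + grid_inner L N p p))"
    by (intro mult_left_mono) simp_all
  with norm_neg1_le[OF assms(1,2,5)] entropy show ?thesis
    unfolding energy_def by (simp add: algebra_simps)
qed

subsection \<open>Fourier projections on the grid\<close>

text \<open>The one-dimensional factor of a Fourier mode; sums and integrals of modes over cubes
  become products of those of waves.\<close>

definition wave :: "real \<Rightarrow> int \<Rightarrow> real \<Rightarrow> complex" where
  "wave L d x = exp (\<i> * of_real (pi / L * (of_int d * x)))"

lemma fourier_mode_wave: "fourier_mode L a b c (x, y, z) = wave L a x * (wave L b y * wave L c z)"
  by (simp add: fourier_mode_def wave_def algebra_simps flip: exp_add)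

lemma wave_mult_cnj: "wave L a x * cnj (wave L b x) = wave L (a - b) x"
  by (simp add: wave_def exp_cnj algebra_simps flip: exp_add)

lemma wave_0 [simp]: "wave L 0 x = 1"
  by (simp add: wave_def)

lemma fourier_mode_mult_cnj:
  "fourier_mode L a b c x * cnj (fourier_mode L a' b' c' x)
    = fourier_mode L (a - a') (b - b') (c - c') x"
proof -
  obtain u v w where x: "x = (u, v, w)" by (metis prod.exhaust)
  show ?thesis
    unfolding x fourier_mode_wave wave_mult_cnj[symmetric] by (simp add: algebra_simps)
qed

text \<open>Moving by one cell multiplies the wave by an \<open>N\<close>-th root of unity
  \<open>w\<close>, so periodicity gives \<open>w * S = S\<close> for the sum S; and
  \<open>w\<close> differs from 1 since 0 < |d| < N.\<close>

lemma sum_wave_cell_centers: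
  assumes "L > 0" "\<bar>d\<bar> < int N"
  shows "(\<Sum>i\<in>{1..int N}. wave L d ((of_int i - 1/2) * mesh L N)) = (if d = 0 then of_nat N else 0)"
proof (cases "d = 0")
  case False
  define u where "u i = wave L d ((of_int i - 1/2) * mesh L N)" for i :: int
  define w where "w = exp (\<i> * of_real (2 * pi * of_int d / real N))"
  have N: "N > 0" using assms by auto
  have step: "u (i + 1) = w * u i" for i
    using assms(1) N
    by (simp add: u_def w_def wave_def mesh_def field_simps flip: exp_add)
  have "u (i + int N) = u i" for i
  proof -
    have arg: "pi / L * (of_int d * ((of_int (i + int N) - 1/2) * mesh L N))
        = pi / L * (of_int d * ((of_int i - 1/2) * mesh L N)) + 2 * pi * of_int d"
      using assms(1) N by (simp add: mesh_def field_simps)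
    have "u (i + int N) = u i * exp (\<i> * of_real (2 * pi * of_int d))"
      unfolding u_def wave_def arg of_real_add distrib_left exp_add ..
    also have "exp (\<i> * of_real (2 * pi * of_int d)) = 1"
      by (auto simp: exp_eq_1)
    finally show ?thesis by simp
  qed
  from periodic_sum_shift[of u, OF this]
  have "w * (\<Sum>i\<in>{1..int N}. u i) = (\<Sum>i\<in>{1..int N}. u i)"
    by (simp add: step sum_distrib_left)
  moreover have "w \<noteq> 1"
  proof
    assume "w = 1"
    then obtain m :: int where "2 * pi * of_int d / real N = of_int (2 * m) * pi"
      by (auto simp: w_def exp_eq_1)
    then have "of_int d = (of_int (m * int N) :: real)"
      using N by (simp add: field_simps)
    then have "d = m * int N"
      by (simp only: of_int_eq_iff)
    then show False
      using assms(2) False by (auto simp: abs_mult)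
  qed
  ultimately show ?thesis
    using False by (simp add: u_def)
qed simp

text \<open>For nonzero \<open>d\<close> the antiderivative takes equal values at \<open>L\<close>
  and \<open>- L\<close>, where the exponents differ by 2 pi i d.\<close>

lemma has_integral_wave:
  assumes "L > 0"
  shows "(wave L d has_integral (if d = 0 then of_real (2 * L) else 0)) {-L..L}"
proof (cases "d = 0")
  case True
  have "wave L 0 = (\<lambda>x. 1)"
    by (simp add: fun_eq_iff)
  with True show ?thesis
    using has_integral_const_real[of "1 :: complex" "-L" L] assms
    by (simp add: scaleR_conv_of_real)
next
  case False
  define k where "k = \<i> * of_real (pi / L * of_int d)"
  have k: "k \<noteq> 0" "k * of_real L = \<i> * of_real (pi * of_int d)"
    using False assms by (simp_all add: k_def)
  have wave: "wave L d x = exp (k * of_real x)" for x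
    by (simp add: wave_def k_def mult.assoc)
  have "((\<lambda>x. exp (k * of_real x) / k) has_vector_derivative exp (k * of_real x)) (at x within {-L..L})" for x
  proof -
    have "((\<lambda>z. exp (k * z) / k) has_field_derivative exp (k * of_real x)) (at (of_real x))"
      using k by (auto intro!: derivative_eq_intros)
    from has_vector_derivative_real_field[OF this] show ?thesis
      by (rule has_vector_derivative_at_within)
  qed
  then have "(wave L d has_integral exp (k * of_real L) / k - exp (k * of_real (- L)) / k) {-L..L}"
    unfolding wave using assms by (intro fundamental_theorem_of_calculus) auto
  moreover have "exp (k * of_real L) = exp (k * of_real (- L))"
  proof -
    have "exp (k * of_real L) = exp (k * of_real (- L)) * exp (\<i> * of_real (2 * pi * of_int d))"
      unfolding exp_add[symmetric] using k(2) by (simp add: algebra_simps)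
    also have "exp (\<i> * of_real (2 * pi * of_int d)) = 1"
      by (auto simp: exp_eq_1)
    finally show ?thesis by simp
  qed
  ultimately show ?thesis
    using False by simp
qed

lemma continuous_on_wave [continuous_intros]:
  "continuous_on A f \<Longrightarrow> continuous_on A (\<lambda>x. wave L d (f x))"
  unfolding wave_def by (intro continuous_intros)

lemma continuous_on_fourier_mode: "continuous_on A (fourier_mode L a b c)"
  unfolding fourier_mode_def case_prod_unfold by (intro continuous_intros)

text \<open>Fubini is applied on the closed cube, where continuity gives integrability; passing to
  the open cube \<open>Omega L\<close> does not change the integral.\<close>

lemma has_integral_fourier_mode:
  assumes "L > 0"
  shows "(fourier_mode L a b c has_integral
    (if a = 0 \<and> b = 0 \<and> c = 0 then of_real ((2 * L)^3) else 0)) (Omega L)"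
proof -
  let ?I = "\<lambda>d::int. if d = 0 then of_real (2 * L) else 0 :: complex"
  have wave: "integral (cbox (- L) L) (wave L d) = ?I d" for d
    using has_integral_wave[OF assms, of d] by (simp add: integral_unique)
  have "integral (cbox (- L, - L, - L) (L, L, L)) (fourier_mode L a b c)
    = integral (cbox (- L) L) (\<lambda>x. integral (cbox (- L, - L) (L, L)) (\<lambda>yz. fourier_mode L a b c (x, yz)))"
    by (rule integral_prod_continuous) (rule continuous_on_fourier_mode)
  also have "\<dots> = integral (cbox (- L) L) (\<lambda>x. integral (cbox (- L, - L) (L, L))
      (\<lambda>yz. wave L a x * (wave L b (fst yz) * wave L c (snd yz))))"
    by (simp add: fourier_mode_wave[symmetric])
  also have "\<dots> = integral (cbox (- L) L) (\<lambda>x. wave L a x * integral (cbox (- L, - L) (L, L))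
      (\<lambda>yz. wave L b (fst yz) * wave L c (snd yz)))"
    by simp
  also have "integral (cbox (- L, - L) (L, L)) (\<lambda>yz. wave L b (fst yz) * wave L c (snd yz))
    = integral (cbox (- L) L) (\<lambda>y. integral (cbox (- L) L) (\<lambda>z. wave L b y * wave L c z))"
    by (subst integral_prod_continuous) (auto intro!: continuous_intros)
  also have "\<dots> = ?I b * ?I c"
    by (simp only: integral_mult_right integral_mult_left wave)
  also have "integral (cbox (- L) L) (\<lambda>x. wave L a x * (?I b * ?I c)) = ?I a * (?I b * ?I c)"
    by (simp only: integral_mult_left wave)
  finally have "integral (cbox (- L, - L, - L) (L, L, L)) (fourier_mode L a b c) = ?I a * (?I b * ?I c)" .
  moreover have "fourier_mode L a b c integrable_on cbox (- L, - L, - L) (L, L, L)"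
    by (intro integrable_continuous continuous_on_fourier_mode)
  ultimately have "(fourier_mode L a b c has_integral ?I a * (?I b * ?I c)) (Omega L)"
    unfolding Omega_def has_integral_open_interval by (simp add: has_integral_integral)
  also have "?I a * (?I b * ?I c) = (if a = 0 \<and> b = 0 \<and> c = 0 then of_real ((2 * L)^3) else 0)"
    by (simp add: power3_eq_cube)
  finally show ?thesis .
qed

lemma sum_fourier_mode_cell_centers:
  assumes "L > 0" "\<bar>a\<bar> < int N" "\<bar>b\<bar> < int N" "\<bar>c\<bar> < int N"
  defines "x \<equiv> \<lambda>i. (of_int i - 1/2) * mesh L N"
  shows "(\<Sum>i\<in>{1..int N}. \<Sum>j\<in>{1..int N}. \<Sum>k\<in>{1..int N}. fourier_mode L a b c (x i, x j, x k))
    = (if a = 0 \<and> b = 0 \<and> c = 0 then of_nat N ^ 3 else 0)"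
proof -
  have "(\<Sum>i\<in>{1..int N}. \<Sum>j\<in>{1..int N}. \<Sum>k\<in>{1..int N}. fourier_mode L a b c (x i, x j, x k))
    = (\<Sum>i\<in>{1..int N}. wave L a (x i)) * ((\<Sum>j\<in>{1..int N}. wave L b (x j)) * (\<Sum>k\<in>{1..int N}. wave L c (x k)))"
    unfolding fourier_mode_wave by (simp only: sum_distrib_left[symmetric] sum_distrib_right[symmetric])
  also have "\<dots> = (if a = 0 \<and> b = 0 \<and> c = 0 then of_nat N ^ 3 else 0)"
    unfolding x_def using assms by (simp add: sum_wave_cell_centers power3_eq_cube)
  finally show ?thesis .
qed

section \<open>Parseval and Bessel for finite orthogonal systems\<close>

text \<open>Parseval's identity on a set of points: after expansion of the square, orthogonality
  leaves only the diagonal of the double sum over modes.\<close>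

lemma sum_norm_square_orthogonal:
  fixes e :: "'m \<Rightarrow> 'x \<Rightarrow> complex"
  assumes "finite M"
    and orth: "\<And>m m'. m \<in> M \<Longrightarrow> m' \<in> M \<Longrightarrow>
      (\<Sum>x\<in>X. e m x * cnj (e m' x)) = (if m = m' then of_real V else 0)"
  shows "(\<Sum>x\<in>X. (cmod (\<Sum>m\<in>M. c m * e m x))\<^sup>2) = V * (\<Sum>m\<in>M. (cmod (c m))\<^sup>2)"
proof -
  have "complex_of_real (\<Sum>x\<in>X. (cmod (\<Sum>m\<in>M. c m * e m x))\<^sup>2)
    = (\<Sum>x\<in>X. \<Sum>m\<in>M. \<Sum>m'\<in>M. c m * cnj (c m') * (e m x * cnj (e m' x)))"
    by (simp add: complex_norm_square sum_product mult_ac del: of_real_power)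
  also have "\<dots> = (\<Sum>m\<in>M. \<Sum>m'\<in>M. \<Sum>x\<in>X. c m * cnj (c m') * (e m x * cnj (e m' x)))"
    by (subst sum.swap) (intro sum.cong refl sum.swap)
  also have "\<dots> = (\<Sum>m\<in>M. \<Sum>m'\<in>M. c m * cnj (c m') * (if m = m' then of_real V else 0))"
    by (intro sum.cong refl) (simp add: orth flip: sum_distrib_left)
  also have "\<dots> = (\<Sum>m\<in>M. of_real V * (c m * cnj (c m)))"
    using assms(1) by (simp add: if_distrib[where f = "\<lambda>z. _ * z"] sum.delta' mult.commute cong: if_cong)
  also have "\<dots> = of_real (V * (\<Sum>m\<in>M. (cmod (c m))\<^sup>2))"
    by (simp add: complex_norm_square sum_distrib_left del: of_real_power)
  finally show ?thesis
    by (simp only: of_real_eq_iff)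
qed

text \<open>With s the sum of the \<open>c m * e m\<close> and C the sum of the squared moduli of
  the \<open>c m\<close>, the integral of |f - s|^2 is I - 2 V C + V C, and it is nonnegative.
  \<open>V\<close> is the common squared norm of the modes, so \<open>V * c m\<close> is the
  unnormalised coefficient.\<close>

lemma Bessel_inequality_has_integral:
  fixes f :: "'n::euclidean_space \<Rightarrow> real" and e :: "'m \<Rightarrow> 'n \<Rightarrow> complex"
  assumes "finite M"
    and f: "((\<lambda>x. (f x)\<^sup>2) has_integral I) S"
    and orth: "\<And>m m'. m \<in> M \<Longrightarrow> m' \<in> M \<Longrightarrow>
      ((\<lambda>x. e m x * cnj (e m' x)) has_integral (if m = m' then of_real V else 0)) S"
    and coeff: "\<And>m. m \<in> M \<Longrightarrow> ((\<lambda>x. of_real (f x) * cnj (e m x)) has_integral of_real V * c m) S"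
  shows "V * (\<Sum>m\<in>M. (cmod (c m))\<^sup>2) \<le> I"
proof -
  let ?s = "\<lambda>x. \<Sum>m\<in>M. c m * e m x"
  let ?C = "\<Sum>m\<in>M. (cmod (c m))\<^sup>2"
  have C: "(\<Sum>m\<in>M. of_real V * (c m * cnj (c m))) = of_real (V * ?C)"
    by (simp add: complex_norm_square sum_distrib_left del: of_real_power)
  \<comment> \<open>The cross term of the expanded square.\<close>
  have 1: "((\<lambda>x. \<Sum>m\<in>M. cnj (c m) * (of_real (f x) * cnj (e m x))) has_integral of_real (V * ?C)) S"
  proof -
    have "((\<lambda>x. \<Sum>m\<in>M. cnj (c m) * (of_real (f x) * cnj (e m x))) has_integral
        (\<Sum>m\<in>M. cnj (c m) * (of_real V * c m))) S"
      using assms(1) by (intro has_integral_sum has_integral_mult_right coeff)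
    also have "(\<Sum>m\<in>M. cnj (c m) * (of_real V * c m)) = (\<Sum>m\<in>M. of_real V * (c m * cnj (c m)))"
      by (intro sum.cong refl) (simp only: mult_ac)
    finally show ?thesis unfolding C .
  qed
  \<comment> \<open>The quadratic term; it has the same integral, so one of the two copies of the
    cross term survives with a minus sign.\<close>
  have 2: "((\<lambda>x. \<Sum>m\<in>M. \<Sum>m'\<in>M. c m * cnj (c m') * (e m x * cnj (e m' x))) has_integral of_real (V * ?C)) S"
  proof -
    have "((\<lambda>x. \<Sum>m\<in>M. \<Sum>m'\<in>M. c m * cnj (c m') * (e m x * cnj (e m' x))) has_integral
        (\<Sum>m\<in>M. \<Sum>m'\<in>M. c m * cnj (c m') * (if m = m' then of_real V else 0))) S"
      using assms(1) by (intro has_integral_sum has_integral_mult_right orth)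
    also have "(\<Sum>m\<in>M. \<Sum>m'\<in>M. c m * cnj (c m') * (if m = m' then of_real V else 0))
        = (\<Sum>m\<in>M. of_real V * (c m * cnj (c m)))"
      using assms(1) by (simp add: if_distrib[where f = "\<lambda>z. _ * z"] sum.delta' mult.commute cong: if_cong)
    finally show ?thesis unfolding C .
  qed
  have "((\<lambda>x. (f x)\<^sup>2 - 2 * Re (\<Sum>m\<in>M. cnj (c m) * (of_real (f x) * cnj (e m x)))
      + Re (\<Sum>m\<in>M. \<Sum>m'\<in>M. c m * cnj (c m') * (e m x * cnj (e m' x)))) has_integral
      I - 2 * Re (of_real (V * ?C)) + Re (of_real (V * ?C))) S"
    by (intro has_integral_add has_integral_diff has_integral_mult_right f
        has_integral_linear[OF 1 bounded_linear_Re, unfolded o_def]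
        has_integral_linear[OF 2 bounded_linear_Re, unfolded o_def])
  moreover have "(f x)\<^sup>2 - 2 * Re (\<Sum>m\<in>M. cnj (c m) * (of_real (f x) * cnj (e m x)))
      + Re (\<Sum>m\<in>M. \<Sum>m'\<in>M. c m * cnj (c m') * (e m x * cnj (e m' x))) = (cmod (of_real (f x) - ?s x))\<^sup>2" for x
  proof -
    have "(\<Sum>m\<in>M. cnj (c m) * (of_real (f x) * cnj (e m x))) = of_real (f x) * cnj (?s x)"
      by (simp add: sum_distrib_left mult_ac)
    moreover have "(\<Sum>m\<in>M. \<Sum>m'\<in>M. c m * cnj (c m') * (e m x * cnj (e m' x))) = ?s x * cnj (?s x)"
      by (simp add: sum_product mult_ac)
    moreover have "r\<^sup>2 - 2 * Re (of_real r * cnj s) + Re (s * cnj s) = (cmod (of_real r - s))\<^sup>2" for r s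
      unfolding cmod_power2 by (simp add: power2_eq_square algebra_simps)
    ultimately show ?thesis
      by (simp only:)
  qed
  ultimately have "((\<lambda>x. (cmod (of_real (f x) - ?s x))\<^sup>2) has_integral I - V * ?C) S"
    by simp
  then have "0 \<le> I - V * ?C"
    by (rule has_integral_nonneg) simp
  then show ?thesis by simp
qed

lemma C_diff_Suc_imp_continuous: "C_diff (Suc k) f \<Longrightarrow> continuous_on UNIV f"
  by (auto intro!: continuous_at_imp_continuous_on differentiable_imp_continuous_within)

text \<open>
  Since \<open>N = 2 K + 1\<close>, no two of the frequencies in use are congruent modulo \<open>N\<close>, so the modes remain
  orthogonal on the grid.
\<close>

lemma grid_inner_initial_grid_le:
  assumes "L > 0" "continuous_on UNIV f" and N_def: "N = 2 * K + 1"
  shows "grid_inner L N (initial_grid L K f) (initial_grid L K f) \<le> integral (Omega L) (\<lambda>x. (f x)\<^sup>2)"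
proof -
  define M where "M = {- int K..int K} \<times> {- int K..int K} \<times> {- int K..int K}"
  define X where "X = {1..int N} \<times> {1..int N} \<times> {1..int N}"
  define pt where "pt = (\<lambda>(i, j, k). ((of_int i - 1/2) * mesh L N, (of_int j - 1/2) * mesh L N,
      (of_int k - 1/2) * mesh L N))"
  define e where "e = (\<lambda>(a, b, c). fourier_mode L a b c)"
  define c where "c = (\<lambda>(a, b, c). fourier_coeff L f a b c)"
  have "finite M" by (simp add: M_def)
  have mesh: "mesh L N * real N = 2 * L"
    by (simp add: mesh_def N_def)
  have init: "initial_grid L K f i j k = Re (\<Sum>m\<in>M. c m * e m (pt (i, j, k)))" for i j k
    by (simp add: initial_grid_def cell_values_def fourier_proj_def M_def c_def e_def pt_def N_def
        sum.cartesian_product case_prod_unfold)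
  have "grid_inner L N (initial_grid L K f) (initial_grid L K f)
    = (mesh L N)^3 * (\<Sum>x\<in>X. (Re (\<Sum>m\<in>M. c m * e m (pt x)))\<^sup>2)"
    by (simp add: grid_inner_def grid_sum_def init X_def sum.cartesian_product case_prod_unfold
        power2_eq_square del: Re_sum)
  \<comment> \<open>The real part is bounded by the modulus, to which the complex orthogonality
    relations apply.\<close>
  also have "\<dots> \<le> (mesh L N)^3 * (\<Sum>x\<in>X. (cmod (\<Sum>m\<in>M. c m * e m (pt x)))\<^sup>2)"
    using assms(1) by (intro mult_left_mono sum_mono) (simp_all add: cmod_power2 mesh_def del: Re_sum Im_sum)
  also have "(\<Sum>x\<in>X. (cmod (\<Sum>m\<in>M. c m * e m (pt x)))\<^sup>2) = real N ^ 3 * (\<Sum>m\<in>M. (cmod (c m))\<^sup>2)"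
  proof (rule sum_norm_square_orthogonal[OF \<open>finite M\<close>])
    fix m m' assume "m \<in> M" "m' \<in> M"
    obtain a b d a' b' d' where m: "m = (a, b, d)" "m' = (a', b', d')"
      by (metis prod.exhaust)
    \<comment> \<open>Frequencies lie between \<open>- int K\<close> and \<open>int K\<close>, so
      their differences are at most 2 K = N - 1 in modulus.\<close>
    have "\<bar>a - a'\<bar> < int N" "\<bar>b - b'\<bar> < int N" "\<bar>d - d'\<bar> < int N"
      using \<open>m \<in> M\<close> \<open>m' \<in> M\<close> by (auto simp: M_def N_def m)
    from sum_fourier_mode_cell_centers[OF assms(1) this]
    show "(\<Sum>x\<in>X. e m (pt x) * cnj (e m' (pt x))) = (if m = m' then of_real (real N ^ 3) else 0)"
      by (simp add: m e_def pt_def X_def fourier_mode_mult_cnj sum.cartesian_product case_prod_unfold)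
  qed
  \<comment> \<open>The cell volume times the number of cells is the volume of the cube, which is
    the squared norm of a mode in the continuous Bessel inequality.\<close>
  also have "(mesh L N)^3 * (real N ^ 3 * (\<Sum>m\<in>M. (cmod (c m))\<^sup>2)) = (2 * L)^3 * (\<Sum>m\<in>M. (cmod (c m))\<^sup>2)"
    unfolding mesh[symmetric] by (simp add: power_mult_distrib)
  also have "\<dots> \<le> integral (Omega L) (\<lambda>x. (f x)\<^sup>2)"
  proof (rule Bessel_inequality_has_integral[OF \<open>finite M\<close>])
    have integrable: "g integrable_on Omega L" if "continuous_on UNIV g" for g :: "point \<Rightarrow> 'b::banach"
      unfolding Omega_def integrable_on_open_interval
      using that by (intro integrable_continuous) (rule continuous_on_subset, auto)
    show "((\<lambda>x. (f x)\<^sup>2) has_integral integral (Omega L) (\<lambda>x. (f x)\<^sup>2)) (Omega L)"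
      using assms(2) by (intro integrable_integral integrable continuous_intros)
    show "((\<lambda>x. e m x * cnj (e m' x)) has_integral (if m = m' then of_real ((2 * L)^3) else 0)) (Omega L)"
      for m m'
    proof -
      obtain a b d a' b' d' where m: "m = (a, b, d)" "m' = (a', b', d')"
        by (metis prod.exhaust)
      show ?thesis
        using has_integral_fourier_mode[OF assms(1), of "a - a'" "b - b'" "d - d'"]
        by (simp add: m e_def fourier_mode_mult_cnj)
    qed
    show "((\<lambda>x. of_real (f x) * cnj (e m x)) has_integral of_real ((2 * L)^3) * c m) (Omega L)" for m
    proof -
      obtain a b d where m: "m = (a, b, d)"
        by (metis prod.exhaust)
      have "of_real ((2 * L)^3) * c m = integral (Omega L) (\<lambda>x. of_real (f x) * cnj (e m x))"
        using assms(1) by (simp add: m c_def e_def fourier_coeff_def Omega_average_def scaleR_conv_of_real)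
      then show ?thesis
        using assms(2)
        by (simp only:) (auto intro!: integrable_integral integrable continuous_intros
            continuous_on_fourier_mode simp: m e_def)
    qed
  qed
  finally show ?thesis .
qed

theorem theorem4p1:
  fixes L :: real and N0 P0 :: "point \<Rightarrow> real"
  assumes "L > 0"
    and "C_diff 6 N0" and "C_diff 6 P0"
    and "Omega_periodic L N0" and "Omega_periodic L P0"
    and "\<And>x. N0 x > 0" and "\<And>x. P0 x > 0"
    and "Omega_average L N0 = Omega_average L P0"
  shows "(\<forall>N dt D n p.
           N \<ge> 1 \<and> dt > 0 \<and> D > 0 \<and> numerical_solution L N D dt n p \<longrightarrow>
           (\<forall>m. energy L N (n (Suc m)) (p (Suc m))
                + dt * (let g = face_grad (mesh L N) (mu_n L N (n (Suc m)) (p (Suc m)));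
                            q = face_grad (mesh L N) (mu_p L N (n (Suc m)) (p (Suc m)))
                        in face_inner L N (face_mult (mobility_n (n m)) g) g
                           + face_inner L N (face_mult (mobility_p D (p m)) q) q)
                \<le> energy L N (n m) (p m)))
         \<and> (\<exists>C0>0. \<forall>K N dt D n p.
           N = 2 * K + 1 \<and> dt > 0 \<and> D > 0 \<and> numerical_solution L N D dt n p
           \<and> n 0 = initial_grid L K N0 \<and> p 0 = initial_grid L K P0 \<longrightarrow>
           (\<forall>m. energy L N (n m) (p m) \<le> energy L N (n 0) (p 0) \<and> energy L N (n 0) (p 0) \<le> C0))"
proof -
  have dissipation: "\<forall>m. energy L N (n (Suc m)) (p (Suc m))
      + dt * (let g = face_grad (mesh L N) (mu_n L N (n (Suc m)) (p (Suc m)));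
                  q = face_grad (mesh L N) (mu_p L N (n (Suc m)) (p (Suc m)))
              in face_inner L N (face_mult (mobility_n (n m)) g) g
                 + face_inner L N (face_mult (mobility_p D (p m)) q) q)
      \<le> energy L N (n m) (p m)"
    if "N \<ge> 1" "dt > 0" "numerical_solution L N D dt n p" for N dt D n p
    using energy_dissipation[OF assms(1) that] by (simp add: Let_def)
  let ?I = "\<lambda>f. integral (Omega L) (\<lambda>x. (f x)\<^sup>2)"
  have cont: "continuous_on UNIV N0" "continuous_on UNIV P0"
    using assms(2,3) C_diff_Suc_imp_continuous[of 5] by (simp_all del: C_diff.simps)
  have initial: "energy L N (n 0) (p 0) \<le> (1 + 6 * L\<^sup>2) * (?I N0 + ?I P0)"
    if N: "N = 2 * K + 1" and sol: "numerical_solution L N D dt n p"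
      and init: "n 0 = initial_grid L K N0" "p 0 = initial_grid L K P0" for K N dt D n p
  proof -
    have "energy L N (n 0) (p 0) \<le> (1 + 6 * L\<^sup>2) * (grid_inner L N (n 0) (n 0) + grid_inner L N (p 0) (p 0))"
      using sol N by (intro energy_le[OF assms(1)]) (auto simp: numerical_solution_def)
    also have "\<dots> \<le> (1 + 6 * L\<^sup>2) * (?I N0 + ?I P0)"
      unfolding init
      by (intro mult_left_mono add_mono grid_inner_initial_grid_le assms(1) cont N) simp
    finally show ?thesis .
  qed
  \<comment> \<open>The maximum with 1 secures a strictly positive constant; its other argument
    depends only on \<open>L\<close> and the continuum data, hence not on \<open>K\<close>.\<close>
  have bound: "energy L N (n m) (p m) \<le> energy L N (n 0) (p 0)
      \<and> energy L N (n 0) (p 0) \<le> max 1 ((1 + 6 * L\<^sup>2) * (?I N0 + ?I P0))"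
    if "N = 2 * K + 1" "dt > 0" "D > 0" "numerical_solution L N D dt n p"
      "n 0 = initial_grid L K N0" "p 0 = initial_grid L K P0" for K N dt D n p m
    using energy_decreasing[OF assms(1) _ that(2-4), of m] initial[OF that(1,4-6)] that(1)
    by (simp add: le_max_iff_disj)
  show ?thesis
  proof (intro conjI exI[of _ "max 1 ((1 + 6 * L\<^sup>2) * (?I N0 + ?I P0))"])
    show "0 < max 1 ((1 + 6 * L\<^sup>2) * (?I N0 + ?I P0))"
      by simp
  qed (use dissipation bound in blast)+
qed

end
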